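(* Let \[ \mathcal D_\downarrow=\{(\alpha,\beta)\in(-1,\infty)^2:\ |\beta|\geq\tfrac12,\ \alpha^2+3\beta^2\geq1\},\qquad \gamma_n=n+\frac{\alpha+\beta+1}{2}. \] For every $(\alpha,\beta)\in\mathcal D_\downarrow$, every integer $n\geq1$, and every $1\leq k\leq n$, \[ \gamma_{n+1}\theta_{n+1,k}^{(\alpha,\beta)}\leq\gamma_n\theta_{n,k}^{(\alpha,\beta)}. \] Equality occurs for some $n$ and $k$ if and only if $|\alpha|=|\beta|=\frac12$; at these four parameter values it occurs for every $n$ and $k$. In particular, for every $(\alpha,\beta)$ in \[ \mathcal D_2=\left\{(\alpha,\beta)\in(-1,\infty)^2:\ |\alpha|\geq\tfrac12,\ |\beta|\geq\tfrac12\right\}\setminus\left\{-\tfrac12,\tfrac12\right\}^{2}, \] every integer $n\ge1$ and every $1\le k\le n$, one has $\gamma_{n+1}\theta_{n+1,k}^{(\alpha,\beta)}<\gamma_n\theta_{n,k}^{(\alpha,\beta)}$.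
   Context: $P_n^{(\alpha,\beta)}$ denotes the Jacobi polynomial of degree $n$ (orthogonal on $(-1,1)$ with respect to the weight $(1-x)^\alpha(1+x)^\beta$). For $\alpha,\beta>-1$ its $n$ zeros are simple and lie in $(-1,1)$; they are written $\cos\theta_{n,k}^{(\alpha,\beta)}$, $1\le k\le n$, with $0<\theta_{n,1}^{(\alpha,\beta)}<\cdots<\theta_{n,n}^{(\alpha,\beta)}<\pi$. *)

theory Defs
  imports "HOL-Analysis.Analysis"
    "HOL-Computational_Algebra.Polynomial"
    "HOL-Computational_Algebra.Formal_Power_Series"
begin

section \<open>Jacobi polynomials\<close>

text \<open>
  The classical normalisation, with value \<open>(n + a) gchoose n\<close> at 1 (Szego, Orthogonal Polynomials,
  eq. (4.3.2)). The facts \<open>degree_jacobi_poly\<close> and \<open>jacobi_poly_orthogonal\<close> below show that,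
  for parameters greater than -1, this is the polynomial of degree \<open>n\<close> orthogonal on (-1,1) to all
  polynomials of smaller degree with respect to the weight \<open>(1 - x)^a (1 + x)^b\<close>.
\<close>

definition jacobi_poly :: "real \<Rightarrow> real \<Rightarrow> nat \<Rightarrow> real poly" where
  "jacobi_poly a b n =
     (\<Sum>s\<le>n. smult (((real n + a) gchoose (n - s)) * ((real n + b) gchoose s))
        ([:-1/2, 1/2:] ^ s * [:1/2, 1/2:] ^ (n - s)))"

lemma poly_jacobi_poly:
  "poly (jacobi_poly a b n) x =
     (\<Sum>s\<le>n. ((real n + a) gchoose (n - s)) * ((real n + b) gchoose s)
        * ((x - 1) / 2) ^ s * ((x + 1) / 2) ^ (n - s))"
proof -
  have "poly [:-1/2, 1/2:] x = (x - 1) / 2" "poly [:1/2, 1/2:] x = (x + 1) / 2"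
    by (simp_all add: field_simps)
  then show ?thesis
    by (simp only: jacobi_poly_def poly_sum poly_smult poly_mult poly_power mult.assoc)
qed

lemma poly_jacobi_poly_1: "poly (jacobi_poly a b n) 1 = (real n + a) gchoose n"
proof -
  have "poly (jacobi_poly a b n) 1 = (\<Sum>s\<le>n. if s = 0 then (real n + a) gchoose n else 0)"
    unfolding poly_jacobi_poly by (intro sum.cong) auto
  then show ?thesis by simp
qed

lemma degree_jacobi_poly:
  assumes "a > -1" "b > -1"
  shows "degree (jacobi_poly a b n) = n"
proof (cases "n = 0")
  case True
  then show ?thesis by (simp add: jacobi_poly_def)
next
  case False
  have deg: "degree ([:-1/2, 1/2:] ^ s * [:1/2, 1/2:: real:] ^ (n - s)) = n" if "s \<le> n" for s
    using that by (subst degree_mult_eq) (auto simp: degree_power_eq)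
  have lc: "coeff ([:-1/2, 1/2:] ^ s * [:1/2, 1/2:: real:] ^ (n - s)) n = (1/2) ^ n" if "s \<le> n" for s
  proof -
    have "coeff ([:-1/2, 1/2:] ^ s * [:1/2, 1/2:: real:] ^ (n - s)) n
        = lead_coeff ([:-1/2, 1/2:] ^ s * [:1/2, 1/2:: real:] ^ (n - s))"
      using deg[OF that] by simp
    also have "\<dots> = (1/2) ^ s * (1/2) ^ (n - s)"
      by (simp only: lead_coeff_mult lead_coeff_power) simp
    also have "\<dots> = (1/2) ^ n"
      using that by (simp flip: power_add)
    finally show ?thesis .
  qed
  have "coeff (jacobi_poly a b n) n =
      (\<Sum>s\<le>n. ((real n + a) gchoose (n - s)) * ((real n + b) gchoose s) * (1/2) ^ n)"
    unfolding jacobi_poly_def coeff_sum coeff_smult by (intro sum.cong) (use lc in auto)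
  also have "\<dots> = (1/2) ^ n * (\<Sum>s=0..n. ((real n + b) gchoose s) * ((real n + a) gchoose (n - s)))"
    by (simp add: sum_distrib_left mult_ac atMost_atLeast0)
  also have "\<dots> = (1/2) ^ n * ((real n + b + (real n + a)) gchoose n)"
    by (simp only: gbinomial_Vandermonde)
  also have "\<dots> = (1/2) ^ n * pochhammer (real n + a + b + 1) n / fact n"
    by (simp add: gbinomial_pochhammer' algebra_simps)
  finally have c: "coeff (jacobi_poly a b n) n = (1/2) ^ n * pochhammer (real n + a + b + 1) n / fact n" .
  have "real n \<ge> 1" using False by simp
  then have "real n + a + b + 1 > 0" using assms by linarith
  then have "coeff (jacobi_poly a b n) n > 0"
    unfolding c by (intro divide_pos_pos mult_pos_pos pochhammer_pos) auto
  then have "degree (jacobi_poly a b n) \<ge> n"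
    by (intro le_degree) auto
  moreover have "degree (jacobi_poly a b n) \<le> n"
    unfolding jacobi_poly_def
  proof (intro degree_sum_le)
    fix s assume "s \<in> {..n}"
    then show "degree (smult (((real n + a) gchoose (n - s)) * ((real n + b) gchoose s))
        ([:-1/2, 1/2:] ^ s * [:1/2, 1/2:] ^ (n - s))) \<le> n"
      using degree_smult_le[of _ "[:-1/2, 1/2:] ^ s * [:1/2, 1/2::real:] ^ (n - s)"] deg[of s]
      by (metis atMost_iff)
  qed simp
  ultimately show ?thesis by simp
qed

lemma has_integral_jacobi_weight:
  fixes a b :: real
  assumes "a > -1" "b > -1"
  shows "((\<lambda>x. (1 - x) powr a * (1 + x) powr b) has_integral
           2 powr (a + b + 1) * Beta (a + 1) (b + 1)) {-1..1}"
proof -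
  have "((\<lambda>t. t powr b * (1 - t) powr a) has_integral Beta (b + 1) (a + 1)) (cbox 0 1)"
    using has_integral_Beta_real[of "b + 1" "a + 1"] assms by simp
  from has_integral_affinity'[OF this, of "1/2" "1/2"]
  have "((\<lambda>x. ((1 + x) / 2) powr b * ((1 - x) / 2) powr a) has_integral 2 * Beta (a + 1) (b + 1)) {-1..1}"
    by (simp add: Beta_commute field_simps)
  from has_integral_mult_right[OF this, of "2 powr (a + b)"]
  have *: "((\<lambda>x. 2 powr (a + b) * (((1 + x) / 2) powr b * ((1 - x) / 2) powr a)) has_integral
      2 powr (a + b) * (2 * Beta (a + 1) (b + 1))) {-1..1}" .
  have eq: "2 powr (a + b) * (2 * Beta (a + 1) (b + 1)) = 2 powr (a + b + 1) * Beta (a + 1) (b + 1)"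
    by (simp add: powr_add)
  show ?thesis
    using * unfolding eq
    by (rule has_integral_eq[rotated]) (auto simp: powr_divide powr_add)
qed

lemma alternating_sum_choose_pochhammer:
  fixes c :: real
  assumes "j < n"
  shows "(\<Sum>s\<le>n. (-1) ^ s * real (n choose s) * pochhammer (c - real s) j) = 0"
  using assms
proof (induction n arbitrary: j c)
  case 0
  then show ?case by simp
next
  case (Suc n)
  define f where "f s = pochhammer (c - real s) j" for s
  have "(\<Sum>s\<le>Suc n. (-1) ^ s * real (Suc n choose s) * f s)
      = f 0 + (\<Sum>s\<le>n. (-1) ^ Suc s * real (Suc n choose Suc s) * f (Suc s))"
    by (subst sum.atMost_Suc_shift) simp
  also have "\<dots> = f 0 + (\<Sum>s\<le>n. (-1) ^ Suc s * real (n choose Suc s) * f (Suc s))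
      - (\<Sum>s\<le>n. (-1) ^ s * real (n choose s) * f (Suc s))"
    by (simp add: algebra_simps sum.distrib sum_negf sum_subtractf)
  also have "f 0 + (\<Sum>s\<le>n. (-1) ^ Suc s * real (n choose Suc s) * f (Suc s))
      = (\<Sum>s\<le>Suc n. (-1) ^ s * real (n choose s) * f s)"
    by (subst sum.atMost_Suc_shift) simp
  also have "\<dots> = (\<Sum>s\<le>n. (-1) ^ s * real (n choose s) * f s)"
    by simp
  also have "\<dots> - (\<Sum>s\<le>n. (-1) ^ s * real (n choose s) * f (Suc s))
      = (\<Sum>s\<le>n. (-1) ^ s * real (n choose s) * (f s - f (Suc s)))"
    by (simp add: algebra_simps sum_subtractf)
  also have "\<dots> = 0"
  proof (cases j)
    case 0
    then show ?thesis by (simp add: f_def)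
  next
    case (Suc i)
    have "f s - f (Suc s) = real (Suc i) * pochhammer (c - real s) i" for s
    proof -
      have "f s = pochhammer (c - real s) i * (c - real s + real i)"
        unfolding f_def Suc by (rule pochhammer_Suc)
      moreover have "f (Suc s) = (c - real s - 1) * pochhammer (c - real s) i"
        unfolding f_def Suc by (subst pochhammer_rec) (simp add: algebra_simps)
      ultimately show ?thesis by (simp add: algebra_simps)
    qed
    then have "(\<Sum>s\<le>n. (-1) ^ s * real (n choose s) * (f s - f (Suc s)))
        = real (Suc i) * (\<Sum>s\<le>n. (-1) ^ s * real (n choose s) * pochhammer (c - real s) i)"
      by (simp add: sum_distrib_left mult_ac)
    then show ?thesis using Suc.IH[of i c] Suc.prems \<open>j = Suc i\<close> by simp
  qed
  finally show ?case by (simp add: f_def)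
qed

lemma jacobi_poly_moment:
  assumes a: "a > -1" and b: "b > -1" and "j < n"
  shows "((\<lambda>x. (1 - x) powr a * (1 + x) powr b * poly (jacobi_poly a b n) x * (1 + x) ^ j)
           has_integral 0) {-1..1}"
proof -
  define A where "A s = ((real n + a) gchoose (n - s)) * ((real n + b) gchoose s)" for s
  define I where "I s = 2 powr (a + b + real n + real j + 1) * Beta (a + real s + 1) (b + real (n - s) + real j + 1)" for s
  have int: "((\<lambda>x. \<Sum>s\<le>n. A s * (-1) ^ s / 2 ^ n *
        ((1 - x) powr (a + real s) * (1 + x) powr (b + real (n - s) + real j))) has_integral
      (\<Sum>s\<le>n. A s * (-1) ^ s / 2 ^ n * I s)) {-1..1}"
  proof (intro has_integral_sum has_integral_mult_right)
    fix s assume "s \<in> {..n}"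
    then have "a + real s + (b + real (n - s) + real j) + 1 = a + b + real n + real j + 1"
      by (simp add: of_nat_diff)
    then show "((\<lambda>x. (1 - x) powr (a + real s) * (1 + x) powr (b + real (n - s) + real j)) has_integral I s) {-1..1}"
      using has_integral_jacobi_weight[of "a + real s" "b + real (n - s) + real j"] a b
      unfolding I_def by (simp add: add_ac)
  qed simp
  have zero: "(\<Sum>s\<le>n. A s * (-1) ^ s / 2 ^ n * I s) = 0"
  proof -
    define C where "C = Gamma (a + real n + 1) * Gamma (b + real n + 1) *
        2 powr (a + b + real n + real j + 1) / (2 ^ n * Gamma (a + b + real n + real j + 2) * fact n)"
    have "A s * (-1) ^ s / 2 ^ n * I s =
        C * ((-1) ^ s * real (n choose s) * pochhammer (b + real n + 1 - real s) j)" if "s \<le> n" for s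
    proof -
      have p: "a + real s + 1 > 0" "b + real n - real s + 1 > 0"
        using a b that by auto
      have np: "a + real s + 1 \<notin> \<int>\<^sub>\<le>\<^sub>0" "b + real n - real s + 1 \<notin> \<int>\<^sub>\<le>\<^sub>0"
        using p by (auto dest: nonpos_Ints_nonpos)
      have g: "Gamma (a + real s + 1) > 0" "Gamma (b + real n - real s + 1) > 0"
        using p by (auto intro!: Gamma_real_pos)
      have 1: "(real n + a) gchoose (n - s) = Gamma (a + real n + 1) / (Gamma (a + real s + 1) * fact (n - s))"
        using pochhammer_Gamma[OF np(1), of "n - s"] that
        by (simp add: gbinomial_pochhammer' of_nat_diff algebra_simps)
      have 2: "(real n + b) gchoose s = Gamma (b + real n + 1) / (Gamma (b + real n - real s + 1) * fact s)"
        using pochhammer_Gamma[OF np(2), of s] by (simp add: gbinomial_pochhammer' algebra_simps)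
      have 3: "pochhammer (b + real n + 1 - real s) j
          = Gamma (b + real n - real s + real j + 1) / Gamma (b + real n - real s + 1)"
        using pochhammer_Gamma[OF np(2), of j] by (simp add: algebra_simps)
      have 4: "real (n choose s) = fact n / (fact s * fact (n - s))"
        using that by (rule binomial_fact)
      have 5: "Beta (a + real s + 1) (b + real (n - s) + real j + 1) =
          Gamma (a + real s + 1) * Gamma (b + real n - real s + real j + 1) / Gamma (a + b + real n + real j + 2)"
        using that by (simp add: Beta_def of_nat_diff algebra_simps)
      show ?thesis
        unfolding A_def I_def C_def 1 2 3 4 5 using g by (simp add: divide_simps)
    qed
    then have "(\<Sum>s\<le>n. A s * (-1) ^ s / 2 ^ n * I s) =
        C * (\<Sum>s\<le>n. (-1) ^ s * real (n choose s) * pochhammer (b + real n + 1 - real s) j)"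
      by (simp add: sum_distrib_left)
    then show ?thesis
      using alternating_sum_choose_pochhammer[OF \<open>j < n\<close>] by simp
  qed
  show ?thesis
  proof (rule has_integral_spike_interior[where a = "-1 :: real" and b = 1, unfolded cbox_interval])
    show "((\<lambda>x. \<Sum>s\<le>n. A s * (-1) ^ s / 2 ^ n *
        ((1 - x) powr (a + real s) * (1 + x) powr (b + real (n - s) + real j))) has_integral 0) {-1..1::real}"
      using int unfolding zero .
    fix x :: real assume "x \<in> box (-1) 1"
    then have x: "1 - x > 0" "1 + x > 0" by auto
    have *: "((x - 1) / 2) ^ s * ((x + 1) / 2) ^ (n - s) = (-1) ^ s / 2 ^ n * ((1 - x) ^ s * (1 + x) ^ (n - s))"
      if "s \<le> n" for s
    proof -
      have "((x - 1) / 2) ^ s = (-1) ^ s * (1 - x) ^ s / 2 ^ s"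
        by (simp add: power_divide flip: power_mult_distrib)
      moreover have "(2::real) ^ s * 2 ^ (n - s) = 2 ^ n"
        using that by (simp flip: power_add)
      ultimately show ?thesis
        by (simp add: power_divide add.commute flip: \<open>2 ^ s * 2 ^ (n - s) = 2 ^ n\<close>)
    qed
    have "poly (jacobi_poly a b n) x =
        (\<Sum>s\<le>n. A s * (((x - 1) / 2) ^ s * ((x + 1) / 2) ^ (n - s)))"
      unfolding poly_jacobi_poly A_def by (simp only: mult.assoc)
    also have "\<dots> = (\<Sum>s\<le>n. A s * ((-1) ^ s / 2 ^ n * ((1 - x) ^ s * (1 + x) ^ (n - s))))"
      by (intro sum.cong refl) (simp only: * atMost_iff)
    finally show "(1 - x) powr a * (1 + x) powr b * poly (jacobi_poly a b n) x * (1 + x) ^ j =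
        (\<Sum>s\<le>n. A s * (-1) ^ s / 2 ^ n *
        ((1 - x) powr (a + real s) * (1 + x) powr (b + real (n - s) + real j)))"
      using x by (auto simp: sum_distrib_left sum_distrib_right powr_add powr_realpow mult_ac
          simp del: of_nat_diff intro!: sum.cong)
  qed
qed

theorem jacobi_poly_orthogonal:
  assumes "a > -1" "b > -1" "degree q < n"
  shows "((\<lambda>x. (1 - x) powr a * (1 + x) powr b * poly (jacobi_poly a b n) x * poly q x)
           has_integral 0) {-1..1}"
proof -
  define r where "r = pcompose q [:-1, 1:]"
  have deg: "degree r < n"
    using assms(3) by (simp add: r_def degree_pcompose)
  have q: "poly q x = (\<Sum>j\<le>degree r. coeff r j * (1 + x) ^ j)" for x
  proof -
    have "poly q x = poly r (1 + x)" by (simp add: r_def poly_pcompose)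
    then show ?thesis by (simp add: poly_altdef)
  qed
  have "((\<lambda>x. \<Sum>j\<le>degree r. coeff r j *
      ((1 - x) powr a * (1 + x) powr b * poly (jacobi_poly a b n) x * (1 + x) ^ j)) has_integral
      (\<Sum>j\<le>degree r. coeff r j * 0)) {-1..1}"
    using assms(1,2) deg
    by (intro has_integral_sum has_integral_mult_right jacobi_poly_moment) auto
  then show ?thesis
    by (simp add: q sum_distrib_left mult_ac)
qed


lemma sign_change_roots:
  fixes p :: "real poly"
  assumes "p \<noteq> 0"
  shows "\<exists>Z c. finite Z \<and> Z \<subseteq> {x. -1 < x \<and> x < 1 \<and> poly p x = 0} \<and> c \<noteq> 0 \<and>
           (\<forall>x\<in>{-1<..<1}. c * poly p x * (\<Prod>z\<in>Z. x - z) \<ge> 0)"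
  using assms
proof (induction "degree p" arbitrary: p rule: less_induct)
  case less
  show ?case
  proof (cases "\<exists>a. -1 < a \<and> a < 1 \<and> poly p a = 0")
    case False
    define c where "c = sgn (poly p 0)"
    have "c \<noteq> 0" using False by (auto simp: c_def sgn_eq_0_iff)
    moreover have "c * poly p x \<ge> 0" if x: "-1 < x" "x < 1" for x
    proof (rule ccontr)
      assume "\<not> c * poly p x \<ge> 0"
      then have "poly p 0 * poly p x < 0"
        by (auto simp: c_def sgn_if mult_less_0_iff split: if_splits)
      then have "x \<noteq> 0" by (auto simp: mult_less_0_iff)
      then consider "0 < x" | "x < 0" by linarith
      then show False
      proof cases
        case 1
        from poly_IVT[OF 1 \<open>poly p 0 * poly p x < 0\<close>] show False using False x by force
      next
        case 2
        from poly_IVT[OF 2, of p] \<open>poly p 0 * poly p x < 0\<close> show False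
          using False x by (force simp: mult.commute)
      qed
    qed
    ultimately show ?thesis
      by (intro exI[of _ "{}"] exI[of _ c]) auto
  next
    case True
    then obtain a where a: "-1 < a" "a < 1" "poly p a = 0" by blast
    then obtain p' where p': "p = [:-a, 1:] * p'"
      by (auto simp: poly_eq_0_iff_dvd elim: dvdE)
    have "p' \<noteq> 0" using less.prems p' by auto
    then have "degree p' < degree p"
      unfolding p' by (subst degree_mult_eq) auto
    from less.hyps[OF this \<open>p' \<noteq> 0\<close>] obtain Z c where Z: "finite Z"
      "Z \<subseteq> {x. -1 < x \<and> x < 1 \<and> poly p' x = 0}" "c \<noteq> 0"
      "\<And>x. x \<in> {-1<..<1} \<Longrightarrow> c * poly p' x * (\<Prod>z\<in>Z. x - z) \<ge> 0"
      by blast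
    have px: "poly p x = (x - a) * poly p' x" for x
      by (simp add: p' algebra_simps)
    show ?thesis
    proof (cases "a \<in> Z")
      case True
      have eq: "c * poly p x * (\<Prod>z\<in>Z - {a}. x - z) = c * poly p' x * (\<Prod>z\<in>Z. x - z)" for x
        using prod.remove[OF Z(1) True, of "\<lambda>z. x - z"] by (simp add: px)
      have "\<forall>x\<in>{-1<..<1}. c * poly p x * (\<Prod>z\<in>Z - {a}. x - z) \<ge> 0"
        unfolding eq using Z(4) by blast
      moreover have "Z - {a} \<subseteq> {x. -1 < x \<and> x < 1 \<and> poly p x = 0}"
        using Z(2) by (auto simp: px)
      ultimately show ?thesis
        using Z(1,3) by blast
    next
      case False
      have eq: "c * poly p x * (\<Prod>z\<in>insert a Z. x - z)
          = (x - a)\<^sup>2 * (c * poly p' x * (\<Prod>z\<in>Z. x - z))" for x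
        using Z(1) False by (simp add: px power2_eq_square)
      have "\<forall>x\<in>{-1<..<1}. c * poly p x * (\<Prod>z\<in>insert a Z. x - z) \<ge> 0"
        unfolding eq using Z(4) by (blast intro: mult_nonneg_nonneg [OF zero_le_power2])
      moreover have "insert a Z \<subseteq> {x. -1 < x \<and> x < 1 \<and> poly p x = 0}"
        using Z(2) a by (auto simp: px)
      ultimately show ?thesis
        using Z(1,3) by blast
    qed
  qed
qed

lemma card_jacobi_poly_roots:
  assumes ab: "a > -1" "b > -1"
  shows "card {x. -1 < x \<and> x < 1 \<and> poly (jacobi_poly a b n) x = 0} = n"
proof (cases "n = 0")
  case True
  then show ?thesis by (simp add: jacobi_poly_def)
next
  case False
  define p where "p = jacobi_poly a b n"
  have deg: "degree p = n" using ab by (simp add: p_def degree_jacobi_poly)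
  then have "p \<noteq> 0" using False by auto
  define R where "R = {x. -1 < x \<and> x < 1 \<and> poly p x = 0}"
  have sub: "R \<subseteq> {x. poly p x = 0}" by (auto simp: R_def)
  have fin: "finite {x. poly p x = 0}" using \<open>p \<noteq> 0\<close> by (rule poly_roots_finite)
  then have "finite R" using sub finite_subset by blast
  have "card R \<le> n"
    using card_mono[OF fin sub] card_poly_roots_bound[OF \<open>p \<noteq> 0\<close>] deg by simp
  moreover have "n \<le> card R"
  proof (rule ccontr)
    assume "\<not> n \<le> card R"
    obtain Z c where Z: "finite Z" "Z \<subseteq> R" "c \<noteq> 0"
      "\<And>x. x \<in> {-1<..<1} \<Longrightarrow> c * poly p x * (\<Prod>z\<in>Z. x - z) \<ge> 0"
      using sign_change_roots[OF \<open>p \<noteq> 0\<close>] unfolding R_def by blast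
    define q where "q = smult c (\<Prod>z\<in>Z. [:-z, 1:])"
    have q: "poly q x = c * (\<Prod>z\<in>Z. x - z)" for x
      by (simp add: q_def poly_prod)
    have "q \<noteq> 0" using Z by (simp add: q_def)
    have "degree q = card Z"
      using Z by (simp add: q_def degree_prod_eq_sum_degree)
    also have "\<dots> \<le> card R" using Z \<open>finite R\<close> by (intro card_mono)
    finally have "degree q < n" using \<open>\<not> n \<le> card R\<close> by simp
    define f where "f x = (1 - x) powr a * (1 + x) powr b * poly p x * poly q x" for x
    have int: "(f has_integral 0) {-1..1}"
      using jacobi_poly_orthogonal[OF ab \<open>degree q < n\<close>] by (simp add: f_def [abs_def] p_def)
    have nonneg: "f x \<ge> 0" if "x \<in> {-1..1}" for x
    proof (cases "x \<in> {-1<..<1}")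
      case True
      have "f x = (1 - x) powr a * (1 + x) powr b * (c * poly p x * (\<Prod>z\<in>Z. x - z))"
        by (simp add: f_def q)
      also have "\<dots> \<ge> 0" by (intro mult_nonneg_nonneg Z True) auto
      finally show ?thesis .
    next
      case False
      then have "x = -1 \<or> x = 1" using that by auto
      then show ?thesis by (auto simp: f_def)
    qed
    have cont: "continuous_on {-1/2..1/2} f"
      unfolding f_def by (intro continuous_intros) auto
    have int': "f integrable_on {-1/2..1/2}"
      using cont by (rule integrable_continuous_real)
    have "integral {-1/2..1/2} f \<le> integral {-1..1} f"
      using int int' nonneg by (intro integral_subset_le) auto
    moreover have "integral {-1/2..1/2} f \<ge> 0"
      using int' nonneg by (intro integral_nonneg) auto
    ultimately have "integral {-1/2..1/2} f = 0"
      using int by (simp add: integral_unique)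
    then have int0: "(f has_integral 0) (cbox (-1/2) (1/2))"
      using int' by (simp add: has_integral_integral)
    have "f x = 0" if "x \<in> {-1/2..1/2}" for x
      by (rule has_integral_0_cbox_imp_0[OF _ _ int0]) (use cont nonneg that in auto)
    then have "poly (p * q) x = 0" if "x \<in> {-1/2..1/2}" for x
      using that by (fastforce simp: f_def)
    then have "{-1/2..1/2} \<subseteq> {x. poly (p * q) x = 0}" by blast
    moreover have "finite {x. poly (p * q) x = 0}"
      using \<open>p \<noteq> 0\<close> \<open>q \<noteq> 0\<close> by (intro poly_roots_finite) auto
    ultimately have "finite {-1/2..1/2::real}" by (rule finite_subset)
    then show False by (simp add: infinite_Icc)
  qed
  ultimately show ?thesis by (simp add: R_def p_def)
qed


section \<open>The angular zeros\<close>

definition jacobi_angles :: "real \<Rightarrow> real \<Rightarrow> nat \<Rightarrow> real set" where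
  "jacobi_angles a b n = {t. 0 < t \<and> t < pi \<and> poly (jacobi_poly a b n) (cos t) = 0}"

text \<open>The index \<open>k\<close> runs from 1 to \<open>n\<close>; list positions start at 0.\<close>

definition jacobi_theta :: "real \<Rightarrow> real \<Rightarrow> nat \<Rightarrow> nat \<Rightarrow> real" where
  "jacobi_theta a b n k = sorted_list_of_set (jacobi_angles a b n) ! (k - 1)"

lemma card_jacobi_angles:
  assumes "a > -1" "b > -1"
  shows "card (jacobi_angles a b n) = n"
proof -
  let ?R = "{x. -1 < x \<and> x < 1 \<and> poly (jacobi_poly a b n) x = 0}"
  have "bij_betw cos (jacobi_angles a b n) ?R"
    unfolding bij_betw_def
  proof
    show "inj_on cos (jacobi_angles a b n)"
      by (rule inj_onI, rule cos_inj_pi) (auto simp: jacobi_angles_def)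
    show "cos ` jacobi_angles a b n = ?R"
    proof (intro equalityI subsetI)
      fix x assume "x \<in> cos ` jacobi_angles a b n"
      then obtain t where "x = cos t" "0 < t" "t < pi" "poly (jacobi_poly a b n) x = 0"
        by (auto simp: jacobi_angles_def)
      then show "x \<in> ?R"
        using cos_monotone_0_pi[of 0 t] cos_monotone_0_pi[of t pi] by auto
    next
      fix x assume "x \<in> ?R"
      then show "x \<in> cos ` jacobi_angles a b n"
        by (intro image_eqI[of _ _ "arccos x"]) (auto simp: jacobi_angles_def arccos_lt_bounded)
    qed
  qed
  from bij_betw_same_card[OF this] show ?thesis
    using card_jacobi_poly_roots[OF assms] by simp
qed

lemma finite_jacobi_angles:
  assumes "a > -1" "b > -1"
  shows "finite (jacobi_angles a b n)"
proof (cases "n = 0")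
  case True
  then show ?thesis by (simp add: jacobi_angles_def jacobi_poly_def)
next
  case False
  then show ?thesis using card_jacobi_angles[OF assms, of n] by (metis card.infinite)
qed

lemma jacobi_theta_in_angles:
  assumes "a > -1" "b > -1" "1 \<le> k" "k \<le> n"
  shows "jacobi_theta a b n k \<in> jacobi_angles a b n"
proof -
  have "k - 1 < length (sorted_list_of_set (jacobi_angles a b n))"
    using assms by (simp add: card_jacobi_angles)
  then have "jacobi_theta a b n k \<in> set (sorted_list_of_set (jacobi_angles a b n))"
    unfolding jacobi_theta_def by (rule nth_mem)
  then show ?thesis using finite_jacobi_angles[OF assms(1,2)] by simp
qed

lemma jacobi_theta_strict_mono:
  assumes "a > -1" "b > -1" "1 \<le> k" "k < l" "l \<le> n"
  shows "jacobi_theta a b n k < jacobi_theta a b n l"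
  unfolding jacobi_theta_def
  using assms by (intro sorted_wrt_nth_less[of "(<)"]) (auto simp: card_jacobi_angles)


section \<open>The scaling factor and the parameter regions\<close>

definition jacobi_gamma :: "real \<Rightarrow> real \<Rightarrow> nat \<Rightarrow> real" where
  "jacobi_gamma a b n = real n + (a + b + 1) / 2"

definition D_down :: "(real \<times> real) set" where
  "D_down = {(a, b). a > -1 \<and> b > -1 \<and> \<bar>b\<bar> \<ge> 1/2 \<and> a\<^sup>2 + 3 * b\<^sup>2 \<ge> 1}"

definition D_2 :: "(real \<times> real) set" where
  "D_2 = {(a, b). a > -1 \<and> b > -1 \<and> \<bar>a\<bar> \<ge> 1/2 \<and> \<bar>b\<bar> \<ge> 1/2} - {-1/2, 1/2} \<times> {-1/2, 1/2}"

end

theory Submission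
  imports Defs "HOL-Real_Asymp.Real_Asymp"
begin

text \<open>
  The proof is Sturm comparison. The substitution \<open>x = cos t\<close> and the factor
  \<open>sin (t/2) powr (a + 1/2) * cos (t/2) powr (b + 1/2)\<close> bring Jacobi's differential equation into
  the normal form \<open>u'' + (\<gamma>\<^sup>2 + V t) * u = 0\<close> with \<open>\<gamma> = jacobi_gamma a b n\<close> and
  \<open>V t = (1/4 - a\<^sup>2) / (4 sin\<^sup>2 (t/2)) + (1/4 - b\<^sup>2) / (4 cos\<^sup>2 (t/2))\<close>. In the
  variable \<open>x = \<gamma> t\<close> the equation becomes \<open>v'' + (1 + V (x/\<gamma>) / \<gamma>\<^sup>2) * v = 0\<close>, and the positive zeros
  of \<open>v\<close> below \<open>pi * \<gamma>\<close> are the scaled angles of the theorem. Hence it suffices to compare the coefficients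
  belonging to \<open>n < m\<close>.

  With \<open>y = x / (2 \<gamma>)\<close> one has
  \<open>x\<^sup>2 V (x/\<gamma>) / \<gamma>\<^sup>2 = (1/4 - a\<^sup>2) (y / sin y)\<^sup>2 + (1/4 - b\<^sup>2) (y / cos y)\<^sup>2\<close>.
  As \<open>y\<close> grows, both squares grow, and the second grows more than three times as fast as the first;
  this last fact reduces to \<open>3 (tan y - y) < tan\<^sup>3 y\<close>. For \<open>a, b > -1\<close>, membership in \<open>D_down\<close> means that
  \<open>1/4 - b\<^sup>2 \<le> 0\<close> and \<open>(1/4 - a\<^sup>2) + 3 (1/4 - b\<^sup>2) \<le> 0\<close>, so away from the four corners the
  combination decreases strictly in \<open>y\<close>, and the coefficient increases strictly in \<open>\<gamma>\<close>
  (\<open>scaled_potential_less\<close>). The solution for \<open>m\<close> therefore has a zero strictly between any two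
  consecutive zeros of the solution for \<open>n\<close>, and also one before the first
  (\<open>sturm_zero_between\<close>), which puts its \<open>k\<close>-th zero strictly to the left.

  The endpoint 0 is singular, and for \<open>a < -1/2\<close> the solutions are unbounded there; the comparison
  on the first interval works because the Wronskian still tends to 0: the two singular factors
  have the same exponent, their logarithmic derivatives differ by \<open>O(x)\<close>, and
  \<open>x powr (2 a + 2)\<close> tends to 0 (\<open>tendsto_jacobi_wronskian\<close>).

  At the corners \<open>V = 0\<close>, the Wronskian vanishes identically, and since the zeros are simple the two solutions
  have the same zeros below \<open>pi * \<gamma>\<close>, which gives equality.
\<close>

section \<open>Jacobi's differential equation\<close>

lemma pderiv_sum: "pderiv (\<Sum>i\<in>A. f i) = (\<Sum>i\<in>A. pderiv (f i))"
  using higher_pderiv_sum[of 1 f A] by simp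

text \<open>
  In the variables \<open>u = (x - 1) / 2\<close> and \<open>w = (x + 1) / 2\<close> we have \<open>1 - x\<^sup>2 = - 4 u w\<close> and
  \<open>w - u = 1\<close>, so the equation can be written homogeneously of degree \<open>n\<close> in \<open>u\<close> and \<open>w\<close>. Comparing
  coefficients, it follows from the two-term recurrence of the products of binomial coefficients.
\<close>

lemma jacobi_ode:
  fixes a b x :: real and n :: nat
  defines "P \<equiv> jacobi_poly a b n"
  shows "(1 - x\<^sup>2) * poly (pderiv (pderiv P)) x + (b - a - (a + b + 2) * x) * poly (pderiv P) x
           + real n * (real n + a + b + 1) * poly P x = 0"
proof -
  define c where "c s = ((real n + a) gchoose (n - s)) * ((real n + b) gchoose s)" for s
  define u where "u = (x - 1) / 2"
  define w where "w = (x + 1) / 2"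
  have c_Suc: "real (Suc s) * (real (Suc s) + a) * c (Suc s) = real (n - s) * (real (n - s) + b) * c s"
    if "s < n" for s
  proof -
    obtain m where m: "n - s = Suc m" using \<open>s < n\<close> by (metis Suc_diff_Suc)
    have nm: "n - Suc s = m" "real n = real s + real m + 1" using m by auto
    have 1: "real (Suc m) * ((real n + a) gchoose Suc m) = (real n + a - real m) * ((real n + a) gchoose m)"
      using gbinomial_mult_1[of "real n + a" m] by (simp add: algebra_simps)
    have 2: "real (Suc s) * ((real n + b) gchoose Suc s) = (real n + b - real s) * ((real n + b) gchoose s)"
      using gbinomial_mult_1[of "real n + b" s] by (simp add: algebra_simps)
    have "real (Suc s) * (real (Suc s) + a) * c (Suc s)
        = ((real n + a - real m) * ((real n + a) gchoose m)) * (real (Suc s) * ((real n + b) gchoose Suc s))"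
      unfolding c_def nm(1) by (simp add: nm(2) algebra_simps)
    also have "\<dots> = (real (Suc m) * ((real n + a) gchoose Suc m)) * ((real n + b - real s) * ((real n + b) gchoose s))"
      by (simp only: 1 2)
    also have "\<dots> = real (n - s) * (real (n - s) + b) * c s"
      unfolding c_def m by (simp add: nm(2) algebra_simps)
    finally show ?thesis .
  qed
  have du: "pderiv ([:-1/2, 1/2:] ^ s) = smult (real s / 2) ([:-1/2, 1/2::real:] ^ (s - 1))" 
    and dw: "pderiv ([:1/2, 1/2:] ^ s) = smult (real s / 2) ([:1/2, 1/2::real:] ^ (s - 1))" for s
    by (cases s; simp add: pderiv_power_Suc pderiv_pCons del: power_Suc)+
  have pu: "poly [:-1/2, 1/2:] x = u" and pw: "poly [:1/2, 1/2:] x = w"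
    by (simp_all add: u_def w_def field_simps)
  have P: "P = (\<Sum>s\<le>n. smult (c s) ([:-1/2, 1/2:] ^ s * [:1/2, 1/2:] ^ (n - s)))"
    unfolding P_def jacobi_poly_def c_def ..
  have P0: "poly P x = (\<Sum>s\<le>n. c s * (u ^ s * w ^ (n - s)))"
    unfolding P by (simp only: poly_sum poly_smult poly_mult poly_power pu pw)
  have P1: "poly (pderiv P) x = (\<Sum>s\<le>n. c s / 2 *
      (real s * u ^ (s - 1) * w ^ (n - s) + real (n - s) * u ^ s * w ^ (n - s - 1)))"
    unfolding P
    by (simp only: pderiv_sum poly_sum poly_smult poly_mult poly_power pu pw pderiv_smult pderiv_mult du dw poly_add)
      (simp add: field_simps del: of_nat_diff)
  have P2: "poly (pderiv (pderiv P)) x = (\<Sum>s\<le>n. c s / 4 *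
      (real s * real (s - 1) * u ^ (s - 2) * w ^ (n - s) + 2 * real s * real (n - s) * u ^ (s - 1) * w ^ (n - s - 1)
       + real (n - s) * real (n - s - 1) * u ^ s * w ^ (n - s - 2)))"
    unfolding P
    by (simp only: pderiv_sum poly_sum poly_smult poly_mult poly_power pu pw pderiv_smult pderiv_mult du dw poly_add
       pderiv_add) (intro sum.cong refl, simp add: field_simps numeral_2_eq_2 del: of_nat_diff)
  \<comment> \<open>\<open>L s\<close> and \<open>R s\<close> collect the terms whose exponents are shifted by one against \<open>T s\<close>; the
     recurrence \<open>c_Suc\<close> shifts them back.\<close>
  define L where "L s = real s * (real s + a) * c s * (u ^ (s - 1) * w ^ (n - s + 1))" for s
  define R where "R s = real (n - s) * (real (n - s) + b) * c s * (u ^ (s + 1) * w ^ (n - s - 1))" for s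
  define T where "T s = c s * (u ^ s * w ^ (n - s))" for s
  have x: "1 - x\<^sup>2 = - 4 * u * w" "b - a - (a + b + 2) * x = - 2 * ((a + 1) * w + (b + 1) * u)"
    by (simp_all add: u_def w_def field_simps power2_eq_square)
  have sumL: "(\<Sum>s\<le>n. L s) = (\<Sum>s\<le>n. real (n - s) * (real (n - s) + b) * T s)"
  proof -
    have "(\<Sum>s\<le>n. L s) = (\<Sum>s<n. L (Suc s))"
      by (subst sum.atMost_shift) (simp add: L_def)
    also have "\<dots> = (\<Sum>s<n. real (n - s) * (real (n - s) + b) * T s)"
    proof (intro sum.cong refl)
      fix s assume "s \<in> {..<n}"
      then have "s < n" "n - Suc s + 1 = n - s" by auto
      then show "L (Suc s) = real (n - s) * (real (n - s) + b) * T s"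
        unfolding L_def T_def c_Suc[OF \<open>s < n\<close>] by simp
    qed
    also have "\<dots> = (\<Sum>s\<le>n. real (n - s) * (real (n - s) + b) * T s)"
      by (intro sum.mono_neutral_left) auto
    finally show ?thesis .
  qed
  have sumR: "(\<Sum>s\<le>n. R s) = (\<Sum>s\<le>n. real s * (real s + a) * T s)"
  proof -
    have "(\<Sum>s\<le>n. R s) = (\<Sum>s<n. R s)"
      by (intro sum.mono_neutral_right) (auto simp: R_def)
    also have "\<dots> = (\<Sum>s<n. real (Suc s) * (real (Suc s) + a) * T (Suc s))"
    proof (intro sum.cong refl)
      fix s assume "s \<in> {..<n}"
      then have "s < n" by auto
      then show "R s = real (Suc s) * (real (Suc s) + a) * T (Suc s)"
        using c_Suc[OF \<open>s < n\<close>] unfolding R_def T_def by (simp add: mult.assoc[symmetric])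
    qed
    also have "\<dots> = (\<Sum>s\<le>n. real s * (real s + a) * T s)"
      using sum.atMost_shift[of "\<lambda>s. real s * (real s + a) * T s" n] by simp
    finally show ?thesis .
  qed
  have "(1 - x\<^sup>2) * poly (pderiv (pderiv P)) x + (b - a - (a + b + 2) * x) * poly (pderiv P) x =
      (\<Sum>s\<le>n. - L s - R s - (2 * real s * real (n - s) + (a + 1) * real (n - s) + (b + 1) * real s) * T s)"
    unfolding P1 P2 sum_distrib_left sum.distrib[symmetric]
  proof (intro sum.cong refl)
    fix s assume "s \<in> {..n}"
    \<comment> \<open>These identities also hold at exponents where the truncated subtraction is off, because the
       factor \<open>real k\<close> or \<open>real k - 1\<close> vanishes there.\<close>
    have red: "y * (real k * y ^ (k - 1)) = real k * y ^ k"
      "y * (real k * (real k - 1) * y ^ (k - 2)) = real k * (real k - 1) * y ^ (k - 1)"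
      "real k * real (k - 1) = real k * (real k - 1)" for y :: real and k
    proof -
      show "y * (real k * y ^ (k - 1)) = real k * y ^ k" by (cases k) auto
      show "y * (real k * (real k - 1) * y ^ (k - 2)) = real k * (real k - 1) * y ^ (k - 1)"
        by (cases k; cases "k - 1") auto
      show "real k * real (k - 1) = real k * (real k - 1)" by (cases k) auto
    qed
    define k where "k = n - s"
    have "(1 - x\<^sup>2) * (c s / 4 * (real s * real (s - 1) * u ^ (s - 2) * w ^ k + 2 * real s * real k * u ^ (s - 1) * w ^ (k - 1)
       + real k * real (k - 1) * u ^ s * w ^ (k - 2)))
      = - c s * ((u * (real s * real (s - 1) * u ^ (s - 2))) * w * w ^ k
          + 2 * (u * (real s * u ^ (s - 1))) * (w * (real k * w ^ (k - 1)))
          + u * u ^ s * (w * (real k * real (k - 1) * w ^ (k - 2))))"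
      unfolding x by (simp add: algebra_simps)
    also have "\<dots> = - c s * (real s * (real s - 1) * u ^ (s - 1) * w ^ (k + 1)
          + 2 * real s * real k * u ^ s * w ^ k + real k * (real k - 1) * u ^ (s + 1) * w ^ (k - 1))"
      unfolding red(3) unfolding red(1,2) by simp
    finally have 1: "(1 - x\<^sup>2) * (c s / 4 * (real s * real (s - 1) * u ^ (s - 2) * w ^ k + 2 * real s * real k * u ^ (s - 1) * w ^ (k - 1)
       + real k * real (k - 1) * u ^ s * w ^ (k - 2))) = \<dots>" .
    have "(b - a - (a + b + 2) * x) * (c s / 2 *
        (real s * u ^ (s - 1) * w ^ k + real k * u ^ s * w ^ (k - 1))) =
      - c s * ((a + 1) * real s * u ^ (s - 1) * w ^ (k + 1) + (a + 1) * u ^ s * (w * (real k * w ^ (k - 1)))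
         + (b + 1) * (u * (real s * u ^ (s - 1))) * w ^ k + (b + 1) * real k * u ^ (s + 1) * w ^ (k - 1))"
      unfolding x by (simp add: field_simps)
    also have "\<dots> = - c s * ((a + 1) * real s * u ^ (s - 1) * w ^ (k + 1) + (a + 1) * real k * u ^ s * w ^ k
         + (b + 1) * real s * u ^ s * w ^ k + (b + 1) * real k * u ^ (s + 1) * w ^ (k - 1))"
      unfolding red(1) by simp
    finally have 2: "(b - a - (a + b + 2) * x) * (c s / 2 *
        (real s * u ^ (s - 1) * w ^ k + real k * u ^ s * w ^ (k - 1))) = \<dots>" .
    show "(1 - x\<^sup>2) * (c s / 4 * (real s * real (s - 1) * u ^ (s - 2) * w ^ (n - s)
         + 2 * real s * real (n - s) * u ^ (s - 1) * w ^ (n - s - 1)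
         + real (n - s) * real (n - s - 1) * u ^ s * w ^ (n - s - 2)))
      + (b - a - (a + b + 2) * x) * (c s / 2 *
         (real s * u ^ (s - 1) * w ^ (n - s) + real (n - s) * u ^ s * w ^ (n - s - 1)))
      = - L s - R s - (2 * real s * real (n - s) + (a + 1) * real (n - s) + (b + 1) * real s) * T s"
      unfolding k_def[symmetric] 1 2 L_def R_def T_def by (simp add: algebra_simps)
  qed
  also have "\<dots> = (\<Sum>s\<le>n. - (real (n - s) * (real (n - s) + b) * T s) - real s * (real s + a) * T s
      - (2 * real s * real (n - s) + (a + 1) * real (n - s) + (b + 1) * real s) * T s)"
    by (simp only: sum_subtractf sum_negf sumL sumR)
  also have "\<dots> = (\<Sum>s\<le>n. - (real n * (real n + a + b + 1)) * T s)"
  proof (intro sum.cong refl)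
    fix s assume "s \<in> {..n}"
    then obtain k where k: "n = s + k" by (auto simp: le_iff_add)
    show "- (real (n - s) * (real (n - s) + b) * T s) - real s * (real s + a) * T s
      - (2 * real s * real (n - s) + (a + 1) * real (n - s) + (b + 1) * real s) * T s
      = - (real n * (real n + a + b + 1)) * T s"
      by (simp add: k algebra_simps)
  qed
  also have "\<dots> = - (real n * (real n + a + b + 1)) * poly P x"
    unfolding P0 T_def sum_distrib_left ..
  finally show ?thesis by simp
qed


section \<open>The normal form\<close>

definition liouville_factor :: "real \<Rightarrow> real \<Rightarrow> real \<Rightarrow> real" where
  "liouville_factor a b t = sin (t / 2) powr (a + 1/2) * cos (t / 2) powr (b + 1/2)"

definition liouville_log_deriv :: "real \<Rightarrow> real \<Rightarrow> real \<Rightarrow> real" where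
  "liouville_log_deriv a b t =
     ((a + 1/2) * (cos (t / 2) / sin (t / 2)) - (b + 1/2) * (sin (t / 2) / cos (t / 2))) / 2"

definition jacobi_potential :: "real \<Rightarrow> real \<Rightarrow> real \<Rightarrow> real" where
  "jacobi_potential a b t = (1/4 - a\<^sup>2) / (4 * (sin (t / 2))\<^sup>2) + (1/4 - b\<^sup>2) / (4 * (cos (t / 2))\<^sup>2)"

definition jacobi_normal :: "real \<Rightarrow> real \<Rightarrow> nat \<Rightarrow> real \<Rightarrow> real" where
  "jacobi_normal a b n t = liouville_factor a b t * poly (jacobi_poly a b n) (cos t)"

text \<open>The derivative of \<open>jacobi_normal\<close> on the open interval from 0 to \<open>pi\<close>.\<close>

definition jacobi_normal' :: "real \<Rightarrow> real \<Rightarrow> nat \<Rightarrow> real \<Rightarrow> real" where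
  "jacobi_normal' a b n t = liouville_factor a b t *
     (liouville_log_deriv a b t * poly (jacobi_poly a b n) (cos t)
      - sin t * poly (pderiv (jacobi_poly a b n)) (cos t))"

lemma half_angle_pos:
  fixes t :: real
  assumes "0 < t" "t < pi"
  shows "sin (t / 2) > 0" "cos (t / 2) > 0"
  using assms by (auto intro!: sin_gt_zero cos_gt_zero)

lemma liouville_factor_pos:
  assumes "0 < t" "t < pi"
  shows "liouville_factor a b t > 0"
  using half_angle_pos[OF assms] by (simp add: liouville_factor_def)

lemma DERIV_liouville_factor:
  assumes t: "0 < t" "t < pi"
  shows "(liouville_factor a b has_real_derivative liouville_factor a b t * liouville_log_deriv a b t) (at t)"
proof -
  note pos = half_angle_pos[OF t]
  have "(liouville_factor a b has_real_derivative
     ((a + 1/2) * sin (t / 2) powr (a + 1/2 - 1) * (cos (t / 2) / 2)) * cos (t / 2) powr (b + 1/2)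
     + sin (t / 2) powr (a + 1/2) * ((b + 1/2) * cos (t / 2) powr (b + 1/2 - 1) * (- sin (t / 2) / 2))) (at t)"
    unfolding liouville_factor_def[abs_def] using pos
    by (auto intro!: derivative_eq_intros simp: algebra_simps)
  also have "((a + 1/2) * sin (t / 2) powr (a + 1/2 - 1) * (cos (t / 2) / 2)) * cos (t / 2) powr (b + 1/2)
     + sin (t / 2) powr (a + 1/2) * ((b + 1/2) * cos (t / 2) powr (b + 1/2 - 1) * (- sin (t / 2) / 2))
     = liouville_factor a b t * liouville_log_deriv a b t"
    unfolding powr_diff liouville_factor_def liouville_log_deriv_def using pos
    by (simp add: field_simps)
  finally show ?thesis .
qed

lemma DERIV_liouville_log_deriv:
  assumes t: "0 < t" "t < pi"
  shows "(liouville_log_deriv a b has_real_derivative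
    - ((a + 1/2) / (sin (t / 2))\<^sup>2 + (b + 1/2) / (cos (t / 2))\<^sup>2) / 4) (at t)"
proof -
  note pos = half_angle_pos[OF t]
  have "((\<lambda>t. cos (t / 2) / sin (t / 2)) has_real_derivative
      (- sin (t / 2) / 2 * sin (t / 2) - cos (t / 2) * (cos (t / 2) / 2)) / (sin (t / 2) * sin (t / 2))) (at t)"
    using pos by (auto intro!: derivative_eq_intros)
  also have "(- sin (t / 2) / 2 * sin (t / 2) - cos (t / 2) * (cos (t / 2) / 2)) / (sin (t / 2) * sin (t / 2))
      = - 1 / (2 * (sin (t / 2))\<^sup>2)"
  proof -
    have "- sin (t / 2) / 2 * sin (t / 2) - cos (t / 2) * (cos (t / 2) / 2) = - 1 / 2"
      using sin_cos_squared_add[of "t / 2"] by (simp add: power2_eq_square)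
    then show ?thesis by (simp only: power2_eq_square; simp)
  qed
  finally have 1: "((\<lambda>t. cos (t / 2) / sin (t / 2)) has_real_derivative - 1 / (2 * (sin (t / 2))\<^sup>2)) (at t)" .
  have "((\<lambda>t. sin (t / 2) / cos (t / 2)) has_real_derivative
      (cos (t / 2) / 2 * cos (t / 2) - sin (t / 2) * (- sin (t / 2) / 2)) / (cos (t / 2) * cos (t / 2))) (at t)"
    using pos by (auto intro!: derivative_eq_intros)
  also have "(cos (t / 2) / 2 * cos (t / 2) - sin (t / 2) * (- sin (t / 2) / 2)) / (cos (t / 2) * cos (t / 2))
      = 1 / (2 * (cos (t / 2))\<^sup>2)"
  proof -
    have "cos (t / 2) / 2 * cos (t / 2) - sin (t / 2) * (- sin (t / 2) / 2) = 1 / 2"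
      using sin_cos_squared_add[of "t / 2"] by (simp add: power2_eq_square)
    then show ?thesis by (simp only: power2_eq_square; simp)
  qed
  finally have 2: "((\<lambda>t. sin (t / 2) / cos (t / 2)) has_real_derivative 1 / (2 * (cos (t / 2))\<^sup>2)) (at t)" .
  show ?thesis
    unfolding liouville_log_deriv_def[abs_def]
    by (rule DERIV_cong[OF DERIV_cdivide[OF DERIV_diff[OF DERIV_cmult[OF 1] DERIV_cmult[OF 2]]]])
      (use pos in \<open>simp add: field_simps\<close>)
qed

lemma DERIV_jacobi_normal:
  assumes t: "0 < t" "t < pi"
  shows "(jacobi_normal a b n has_real_derivative jacobi_normal' a b n t) (at t)"
  unfolding jacobi_normal_def[abs_def] jacobi_normal'_def
  by (rule derivative_eq_intros DERIV_liouville_factor[OF t] DERIV_chain2[OF poly_DERIV DERIV_cos] refl)+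
    (simp add: algebra_simps)

text \<open>
  With the logarithmic derivative \<open>g\<close> of the Liouville factor, \<open>2 g\<close> is the coefficient of the
  first-order term of Jacobi's equation in the variable \<open>t\<close>. The first derivative of the polynomial
  therefore cancels, and what remains of \<open>g\<close> is \<open>g\<^sup>2 + g'\<close>, which supplies the potential and
  completes the square in \<open>\<gamma>\<close>.
\<close>

lemma DERIV_jacobi_normal':
  assumes t: "0 < t" "t < pi"
  shows "(jacobi_normal' a b n has_real_derivative
     - ((jacobi_gamma a b n)\<^sup>2 + jacobi_potential a b t) * jacobi_normal a b n t) (at t)"
proof -
  note pos = half_angle_pos[OF t]
  define P where "P = jacobi_poly a b n"
  define m where "m = liouville_factor a b t"
  define g where "g = liouville_log_deriv a b t"
  define g' where "g' = - ((a + 1/2) / (sin (t / 2))\<^sup>2 + (b + 1/2) / (cos (t / 2))\<^sup>2) / 4"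
  define y where "y = poly P (cos t)"
  define y' where "y' = poly (pderiv P) (cos t)"
  define y'' where "y'' = poly (pderiv (pderiv P)) (cos t)"
  define S where "S = sin (t / 2)"
  define C where "C = cos (t / 2)"
  have S: "S > 0" and C: "C > 0" using pos by (auto simp: S_def C_def)
  have SC: "S\<^sup>2 + C\<^sup>2 = 1" by (simp add: S_def C_def)
  have st: "sin t = 2 * S * C" and ct: "cos t = C\<^sup>2 - S\<^sup>2"
    using sin_double[of "t / 2"] cos_double[of "t / 2"] by (simp_all add: S_def C_def)
  have D: "(jacobi_normal' a b n has_real_derivative
     m * (g * (g * y - sin t * y') + (g' * y - g * sin t * y' - cos t * y' + (sin t)\<^sup>2 * y''))) (at t)"
    unfolding jacobi_normal'_def[abs_def] m_def g_def y_def y'_def y''_def P_def g'_def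
    by (rule derivative_eq_intros DERIV_liouville_factor[OF t] DERIV_liouville_log_deriv[OF t]
        DERIV_chain2[OF poly_DERIV DERIV_cos] refl)+
      (simp add: algebra_simps power2_eq_square)
  have gs: "2 * g * sin t = (a + b + 1) * cos t + (a - b)"
  proof -
    have "2 * g * sin t = (2 * a + 1) * C\<^sup>2 - (2 * b + 1) * S\<^sup>2"
      unfolding st g_def liouville_log_deriv_def S_def[symmetric] C_def[symmetric] using S C
      by (simp add: field_simps power2_eq_square)
    also have "\<dots> = (a + b + 1) * (C\<^sup>2 - S\<^sup>2) + (a - b) * (S\<^sup>2 + C\<^sup>2)"
      by (simp add: algebra_simps)
    finally show ?thesis by (simp only: SC ct) simp
  qed
  have gg: "g\<^sup>2 + g' = - ((a + b + 1) / 2)\<^sup>2 - jacobi_potential a b t"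
  proof -
    define X where "X = 1 / S\<^sup>2"
    define Y where "Y = 1 / C\<^sup>2"
    have "g\<^sup>2 = ((a + 1/2)\<^sup>2 * (C\<^sup>2 / S\<^sup>2) + (b + 1/2)\<^sup>2 * (S\<^sup>2 / C\<^sup>2) - 2 * (a + 1/2) * (b + 1/2)) / 4"
      unfolding g_def liouville_log_deriv_def S_def[symmetric] C_def[symmetric] using S C
      by (simp add: power2_eq_square divide_simps) (simp add: algebra_simps)
    moreover have "C\<^sup>2 / S\<^sup>2 = X - 1" "S\<^sup>2 / C\<^sup>2 = Y - 1"
      using S C SC by (simp_all add: X_def Y_def field_simps)
    ultimately have 1: "g\<^sup>2 = ((a + 1/2)\<^sup>2 * (X - 1) + (b + 1/2)\<^sup>2 * (Y - 1) - 2 * (a + 1/2) * (b + 1/2)) / 4"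
      by simp
    have 2: "g' = - ((a + 1/2) * X + (b + 1/2) * Y) / 4"
      unfolding g'_def S_def C_def X_def Y_def by simp
    have 3: "jacobi_potential a b t = (1/4 - a\<^sup>2) / 4 * X + (1/4 - b\<^sup>2) / 4 * Y"
      unfolding jacobi_potential_def S_def C_def X_def Y_def by simp
    show ?thesis
      unfolding 1 2 3 by (simp add: field_simps power2_eq_square)
  qed
  have gamma: "(jacobi_gamma a b n)\<^sup>2 = real n * (real n + a + b + 1) + ((a + b + 1) / 2)\<^sup>2"
    by (simp add: jacobi_gamma_def power2_eq_square field_simps)
  have "g * (g * y - sin t * y') + (g' * y - g * sin t * y' - cos t * y' + (sin t)\<^sup>2 * y'')
      = (g\<^sup>2 + g') * y + ((sin t)\<^sup>2 * y'' - (2 * g * sin t) * y' - cos t * y')"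
    by (simp add: algebra_simps power2_eq_square)
  also have "\<dots> = (g\<^sup>2 + g') * y - real n * (real n + a + b + 1) * y"
    using jacobi_ode[of "cos t" a b n] unfolding gs sin_squared_eq y_def y'_def y''_def P_def
    by (simp add: algebra_simps)
  also have "\<dots> = - ((jacobi_gamma a b n)\<^sup>2 + jacobi_potential a b t) * y"
    unfolding gg gamma by (simp add: algebra_simps)
  finally show ?thesis
    using D by (simp add: jacobi_normal_def m_def y_def P_def mult_ac)
qed

section \<open>Two trigonometric quotients\<close>

lemma mult_cos_less_sin:
  fixes x :: real
  assumes "0 < x" "x < pi / 2"
  shows "x * cos x < sin x"
proof -
  have "(\<lambda>x. sin x - x * cos x) 0 < (\<lambda>x. sin x - x * cos x) x"
  proof (rule DERIV_pos_imp_increasing_open[OF assms(1)])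
    fix t :: real assume t: "0 < t" "t < x"
    have "((\<lambda>x. sin x - x * cos x) has_real_derivative t * sin t) (at t)"
      by (auto intro!: derivative_eq_intros)
    moreover have "t * sin t > 0" using t assms by (intro mult_pos_pos sin_gt_zero) auto
    ultimately show "\<exists>y. ((\<lambda>x. sin x - x * cos x) has_real_derivative y) (at t) \<and> 0 < y" by blast
  qed (auto intro!: continuous_intros)
  then show ?thesis by simp
qed

text \<open>The difference of the two sides vanishes at 0 and has derivative \<open>3 tan\<^sup>4\<close>.\<close>

lemma tan_cubic_bound:
  fixes x :: real
  assumes x: "0 < x" "x < pi / 2"
  shows "3 * (tan x - x) < tan x ^ 3"
proof -
  have "(\<lambda>x. tan x ^ 3 - 3 * (tan x - x)) 0 < (\<lambda>x. tan x ^ 3 - 3 * (tan x - x)) x"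
  proof (rule DERIV_pos_imp_increasing_open[OF x(1)])
    fix t :: real assume t: "0 < t" "t < x"
    have c: "cos t > 0" using t x by (intro cos_gt_zero) auto
    have "((\<lambda>x. tan x ^ 3 - 3 * (tan x - x)) has_real_derivative
        3 * tan t ^ 2 * inverse ((cos t)\<^sup>2) - 3 * (inverse ((cos t)\<^sup>2) - 1)) (at t)"
      using c by (auto intro!: derivative_eq_intros)
    also have "inverse ((cos t)\<^sup>2) = 1 + tan t ^ 2"
      using c tan_sec[of t] by (simp add: power_inverse)
    finally have "((\<lambda>x. tan x ^ 3 - 3 * (tan x - x)) has_real_derivative 3 * tan t ^ 4) (at t)"
      by (simp add: algebra_simps eval_nat_numeral)
    moreover have "3 * tan t ^ 4 > 0" using t x tan_gt_zero[of t] by simp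
    ultimately show "\<exists>y. ((\<lambda>x. tan x ^ 3 - 3 * (tan x - x)) has_real_derivative y) (at t) \<and> 0 < y" by blast
  next
    have "\<forall>t\<in>{0..x}. cos t \<noteq> 0"
    proof
      fix t assume "t \<in> {0..x}"
      then have "cos t > 0" using x by (intro cos_gt_zero_pi) auto
      then show "cos t \<noteq> 0" by simp
    qed
    then show "continuous_on {0..x} (\<lambda>x. tan x ^ 3 - 3 * (tan x - x))"
      by (auto intro!: continuous_intros)
  qed
  then show ?thesis by simp
qed

text \<open>
  After division by \<open>2 t / cos\<^sup>2 t\<close> the derivatives of \<open>(t / cos t)\<^sup>2\<close> and of \<open>(t / sin t)\<^sup>2\<close> are
  \<open>1 + t T\<close> and \<open>(T - t) / T\<^sup>3\<close> with \<open>T = tan t\<close>, and the latter is below \<open>1/3\<close> by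
  \<open>tan_cubic_bound\<close>. The factor 3 is optimal: near 0 the squares are \<open>t\<^sup>2 + \<dots>\<close> and
  \<open>1 + t\<^sup>2 / 3 + \<dots>\<close>. This is where the 3 in the definition of \<open>D_down\<close> comes from.
\<close>

lemma sq_quotients_increase:
  fixes x y :: real
  assumes x: "0 < x" "x < y" "y < pi / 2"
  shows "(x / sin x)\<^sup>2 < (y / sin y)\<^sup>2"
    and "(x / cos x)\<^sup>2 - 3 * (x / sin x)\<^sup>2 < (y / cos y)\<^sup>2 - 3 * (y / sin y)\<^sup>2"
proof -
  have pos: "sin t > 0" "cos t > 0" if "x \<le> t" "t \<le> y" for t
    using that x by (auto intro!: sin_gt_zero cos_gt_zero)
  define f where "f t = 2 * t * (sin t - t * cos t) / sin t ^ 3" for t :: real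
  define k where "k t = 2 * t * (cos t + t * sin t) / cos t ^ 3" for t :: real
  have Df: "((\<lambda>t. (t / sin t)\<^sup>2) has_real_derivative f t) (at t)" if "x \<le> t" "t \<le> y" for t
    unfolding f_def using pos[OF that]
    by (auto intro!: derivative_eq_intros simp: field_simps eval_nat_numeral)
  have Dk: "((\<lambda>t. (t / cos t)\<^sup>2) has_real_derivative k t) (at t)" if "x \<le> t" "t \<le> y" for t
    unfolding k_def using pos[OF that]
    by (auto intro!: derivative_eq_intros simp: field_simps eval_nat_numeral)
  show "(x / sin x)\<^sup>2 < (y / sin y)\<^sup>2"
  proof (rule DERIV_pos_imp_increasing[OF x(2)])
    fix t assume t: "x \<le> t" "t \<le> y"
    have "f t > 0"
      unfolding f_def using pos[OF t] mult_cos_less_sin[of t] t x by simp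
    then show "\<exists>d. ((\<lambda>t. (t / sin t)\<^sup>2) has_real_derivative d) (at t) \<and> 0 < d"
      using Df[OF t] by blast
  qed
  show "(x / cos x)\<^sup>2 - 3 * (x / sin x)\<^sup>2 < (y / cos y)\<^sup>2 - 3 * (y / sin y)\<^sup>2"
  proof (rule DERIV_pos_imp_increasing[OF x(2), of "\<lambda>t. (t / cos t)\<^sup>2 - 3 * (t / sin t)\<^sup>2"])
    fix t assume t: "x \<le> t" "t \<le> y"
    define T where "T = tan t"
    have c: "cos t > 0" and T: "T > 0" "3 * (T - t) < T ^ 3" and tp: "t > 0"
      using pos[OF t] tan_cubic_bound[of t] tan_gt_zero[of t] t x by (auto simp: T_def)
    have s: "sin t = T * cos t" using c by (simp add: T_def tan_def)
    have "3 * (T - t) < T ^ 3 * (1 + t * T)"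
    proof -
      have "0 < T ^ 3 * (t * T)" using T tp by simp
      then show ?thesis using T(2) by (simp only: distrib_left mult_1_right)
    qed
    then have "3 * ((T - t) / T ^ 3) < 1 + t * T"
      using T by (simp add: field_simps)
    then have "2 * t / (cos t)\<^sup>2 * (3 * ((T - t) / T ^ 3)) < 2 * t / (cos t)\<^sup>2 * (1 + t * T)"
      using c tp by (intro mult_strict_left_mono) auto
    moreover have "3 * f t = 2 * t / (cos t)\<^sup>2 * (3 * ((T - t) / T ^ 3))"
      unfolding f_def s using c T by (simp add: field_simps eval_nat_numeral)
    moreover have "k t = 2 * t / (cos t)\<^sup>2 * (1 + t * T)"
      unfolding k_def s using c T by (simp add: field_simps eval_nat_numeral)
    ultimately have "0 < k t - 3 * f t" by simp
    moreover have "((\<lambda>t. (t / cos t)\<^sup>2 - 3 * (t / sin t)\<^sup>2) has_real_derivative k t - 3 * f t) (at t)"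
      by (intro derivative_intros Df Dk t DERIV_diff DERIV_cmult)
    ultimately show "\<exists>d. ((\<lambda>t. (t / cos t)\<^sup>2 - 3 * (t / sin t)\<^sup>2) has_real_derivative d) (at t) \<and> 0 < d"
      by blast
  qed
qed

text \<open>
  Writing the increments of the two squares as \<open>F\<close> and \<open>K\<close>, the increment of the combination is
  \<open>(A + 3 B) F + B (K - 3 F)\<close>, where \<open>F\<close> and \<open>K - 3 F\<close> are positive. This covers both signs of \<open>A\<close>
  at once.
\<close>

lemma weighted_sq_quotients_decrease:
  fixes A B x y :: real
  assumes x: "0 < x" "x < y" "y < pi / 2"
    and B: "B \<le> 0" "A + 3 * B \<le> 0" "A \<noteq> 0 \<or> B \<noteq> 0"
  shows "A * (y / sin y)\<^sup>2 + B * (y / cos y)\<^sup>2 < A * (x / sin x)\<^sup>2 + B * (x / cos x)\<^sup>2"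
proof -
  define F where "F = (y / sin y)\<^sup>2 - (x / sin x)\<^sup>2"
  define K where "K = (y / cos y)\<^sup>2 - (x / cos x)\<^sup>2"
  have F: "F > 0" and K: "K > 3 * F"
    using sq_quotients_increase[OF x] by (auto simp: F_def K_def)
  have "(A + 3 * B) * F + B * (K - 3 * F) < 0"
  proof (cases "B = 0")
    case True
    then show ?thesis using B F by (auto simp: mult_less_0_iff)
  next
    case False
    then show ?thesis using B F K
      by (intro add_nonpos_neg mult_nonpos_nonneg mult_neg_pos) auto
  qed
  then show ?thesis by (simp add: F_def K_def algebra_simps)
qed

section \<open>Sturm comparison\<close>

lemma constant_sign_on_interval:
  fixes f :: "real \<Rightarrow> real"
  assumes "continuous_on {a<..<b} f" "\<And>x. a < x \<Longrightarrow> x < b \<Longrightarrow> f x \<noteq> 0"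
  obtains s where "s \<noteq> 0" "\<And>x. a < x \<Longrightarrow> x < b \<Longrightarrow> s * f x > 0"
proof -
  have conn: "connected (f ` {a<..<b})"
    using assms(1) by (intro connected_continuous_image) auto
  have no0: "0 \<notin> f ` {a<..<b}" using assms(2) by force
  have "(\<forall>x. a < x \<and> x < b \<longrightarrow> f x > 0) \<or> (\<forall>x. a < x \<and> x < b \<longrightarrow> f x < 0)"
  proof (rule ccontr)
    assume "\<not> ?thesis"
    then obtain x y where "x \<in> {a<..<b}" "y \<in> {a<..<b}" "f x \<le> 0" "0 \<le> f y"
      by (meson greaterThanLessThan_iff not_less)
    then have "0 \<in> f ` {a<..<b}"
      using connectedD_interval[OF conn, of "f x" "f y" 0] by auto
    then show False using no0 by blast
  qed
  then show ?thesis
    using that[of 1] that[of "-1"] by auto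
qed

lemma DERIV_wronskian:
  fixes v v' w w' q r :: "real \<Rightarrow> real"
  assumes "(v has_real_derivative v' x) (at x)" "(v' has_real_derivative - q x * v x) (at x)"
    and "(w has_real_derivative w' x) (at x)" "(w' has_real_derivative - r x * w x) (at x)"
  shows "((\<lambda>x. v x * w' x - v' x * w x) has_real_derivative (q x - r x) * (v x * w x)) (at x)"
  by (rule derivative_eq_intros assms refl)+ (simp add: algebra_simps)

text \<open>
  While \<open>v w > 0\<close>, the Wronskian decreases strictly, so it cannot have a limit at most 0 on the left
  and a limit at least 0 on the right. The endpoints enter only through these limits, which admits
  solutions that are singular there.
\<close>

lemma wronskian_limits_contradiction:
  fixes v v' w w' q r :: "real \<Rightarrow> real"
  assumes "a < b"
    and D: "\<And>x. a < x \<Longrightarrow> x < b \<Longrightarrow> (v has_real_derivative v' x) (at x)"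
      "\<And>x. a < x \<Longrightarrow> x < b \<Longrightarrow> (v' has_real_derivative - q x * v x) (at x)"
      "\<And>x. a < x \<Longrightarrow> x < b \<Longrightarrow> (w has_real_derivative w' x) (at x)"
      "\<And>x. a < x \<Longrightarrow> x < b \<Longrightarrow> (w' has_real_derivative - r x * w x) (at x)"
    and less: "\<And>x. a < x \<Longrightarrow> x < b \<Longrightarrow> q x < r x"
    and pos: "\<And>x. a < x \<Longrightarrow> x < b \<Longrightarrow> v x * w x > 0"
    and L: "((\<lambda>x. v x * w' x - v' x * w x) \<longlongrightarrow> L) (at_right a)" "L \<le> 0"
    and M: "((\<lambda>x. v x * w' x - v' x * w x) \<longlongrightarrow> M) (at_left b)" "M \<ge> 0"
  shows False
proof -
  define W where "W x = v x * w' x - v' x * w x" for x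
  have decr: "W y < W x" if "a < x" "x < y" "y < b" for x y
  proof (rule DERIV_neg_imp_decreasing[OF that(2)])
    fix t assume "x \<le> t" "t \<le> y"
    then have t: "a < t" "t < b" using that by auto
    then have "(W has_real_derivative (q t - r t) * (v t * w t)) (at t)"
      unfolding W_def[abs_def] by (intro DERIV_wronskian D)
    moreover have "(q t - r t) * (v t * w t) < 0"
      using less[OF t] pos[OF t] by (simp add: mult_neg_pos)
    ultimately show "\<exists>d. (W has_real_derivative d) (at t) \<and> d < 0" by blast
  qed
  obtain c d where cd: "a < c" "c < d" "d < b"
    using \<open>a < b\<close> dense by meson
  have "eventually (\<lambda>x. W c \<le> W x) (at_right a)"
    using eventually_at_right_less[of a] eventually_at_right_real[OF cd(1)]
    by eventually_elim (use decr cd in \<open>force intro: less_imp_le\<close>)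
  then have "W c \<le> L"
    using L(1) unfolding W_def by (intro tendsto_lowerbound) auto
  moreover have "eventually (\<lambda>x. W x \<le> W d) (at_left b)"
    using eventually_at_left_real[OF cd(3)]
    by eventually_elim (use decr cd in \<open>force intro: less_imp_le\<close>)
  then have "M \<le> W d"
    using M(1) unfolding W_def by (intro tendsto_upperbound) auto
  ultimately show False
    using decr[OF cd] L(2) M(2) by linarith
qed

text \<open>
  If \<open>w\<close> had no zero in the interval, both functions could be normalised to be positive there. At a
  zero of \<open>v\<close> the Wronskian is \<open>- v' w\<close>, where \<open>w\<close> is nonnegative by continuity, and \<open>v'\<close> is
  nonnegative at a left endpoint and nonpositive at a right one. At the singular left endpoint 0 the
  limit of the Wronskian is an assumption.
\<close>

lemma sturm_zero_between:
  fixes v v' w w' q r :: "real \<Rightarrow> real"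
  assumes "0 \<le> a" "a < b" "b < c"
    and D: "\<And>x. 0 < x \<Longrightarrow> x < c \<Longrightarrow> (v has_real_derivative v' x) (at x)"
      "\<And>x. 0 < x \<Longrightarrow> x < c \<Longrightarrow> (v' has_real_derivative - q x * v x) (at x)"
      "\<And>x. 0 < x \<Longrightarrow> x < c \<Longrightarrow> (w has_real_derivative w' x) (at x)"
      "\<And>x. 0 < x \<Longrightarrow> x < c \<Longrightarrow> (w' has_real_derivative - r x * w x) (at x)"
    and less: "\<And>x. 0 < x \<Longrightarrow> x < c \<Longrightarrow> q x < r x"
    and W0: "((\<lambda>x. v x * w' x - v' x * w x) \<longlongrightarrow> 0) (at_right 0)"
    and nz: "\<And>x. a < x \<Longrightarrow> x < b \<Longrightarrow> v x \<noteq> 0"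
    and "a = 0 \<or> v a = 0" "v b = 0"
  shows "\<exists>x. a < x \<and> x < b \<and> w x = 0"
proof (rule ccontr)
  assume "\<not> ?thesis"
  then have nzw: "\<And>x. a < x \<Longrightarrow> x < b \<Longrightarrow> w x \<noteq> 0" by blast
  have in_c: "0 < x \<and> x < c" if "a < x" "x \<le> b" for x
    using that assms(1-3) by auto
  have cont: "isCont v x" "isCont v' x" "isCont w x" "isCont w' x" if "0 < x" "x < c" for x
    using D[OF that] by (blast intro: DERIV_isCont)+
  have "continuous_on {a<..<b} v" "continuous_on {a<..<b} w"
    using in_c by (auto intro!: continuous_at_imp_continuous_on cont)
  obtain s where s: "s \<noteq> 0" "\<And>x. a < x \<Longrightarrow> x < b \<Longrightarrow> s * v x > 0"
    using constant_sign_on_interval[OF \<open>continuous_on {a<..<b} v\<close> nz] by metis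
  obtain t where t: "t \<noteq> 0" "\<And>x. a < x \<Longrightarrow> x < b \<Longrightarrow> t * w x > 0"
    using constant_sign_on_interval[OF \<open>continuous_on {a<..<b} w\<close> nzw] by metis
  have Dsv: "((\<lambda>x. s * v x) has_real_derivative s * v' x) (at x)" if "0 < x" "x < c" for x
    using D(1)[OF that] by (rule DERIV_cmult)
  have lim: "((\<lambda>x. s * v x * (t * w' x) - s * v' x * (t * w x)) \<longlongrightarrow>
      s * v z * (t * w' z) - s * v' z * (t * w z)) (at z within S)" if "0 < z" "z < c" for z S
    by (intro tendsto_intros isCont_tendsto_compose[OF _ tendsto_ident_at] cont that)
  have b: "0 < b" "b < c" using assms(1-3) by auto
  have "t * w b \<ge> 0"
  proof (rule tendsto_lowerbound)
    show "((\<lambda>x. t * w x) \<longlongrightarrow> t * w b) (at_left b)"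
      by (intro tendsto_intros isCont_tendsto_compose[OF _ tendsto_ident_at] cont b)
    show "eventually (\<lambda>x. 0 \<le> t * w x) (at_left b)"
      using eventually_at_left_real[OF \<open>a < b\<close>] by eventually_elim (use t in \<open>force intro: less_imp_le\<close>)
  qed simp
  moreover have "s * v' b \<le> 0"
  proof (rule ccontr)
    assume "\<not> s * v' b \<le> 0"
    then obtain d where d: "d > 0" "\<And>h. 0 < h \<Longrightarrow> h < d \<Longrightarrow> s * v (b - h) < s * v b"
      using DERIV_pos_inc_left[OF Dsv[OF b]] by (auto simp: not_le)
    define h where "h = min (d / 2) ((b - a) / 2)"
    have "0 < h" "h < d" "a < b - h" "b - h < b" using d(1) \<open>a < b\<close> by (auto simp: h_def min_def field_simps)
    then show False using d(2)[of h] s(2)[of "b - h"] \<open>v b = 0\<close> by simp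
  qed
  ultimately have Mb: "s * v b * (t * w' b) - s * v' b * (t * w b) \<ge> 0"
    using \<open>v b = 0\<close> by (simp add: mult_nonpos_nonneg)
  have "\<exists>L\<le>0. ((\<lambda>x. s * v x * (t * w' x) - s * v' x * (t * w x)) \<longlongrightarrow> L) (at_right a)"
  proof (cases "a = 0")
    case True
    have "((\<lambda>x. s * t * (v x * w' x - v' x * w x)) \<longlongrightarrow> s * t * 0) (at_right 0)"
      using W0 by (rule tendsto_mult_left)
    then show ?thesis using True by (auto simp: algebra_simps)
  next
    case False
    then have a: "0 < a" "a < c" "v a = 0" using assms(1-3,11) by auto
    have "t * w a \<ge> 0"
    proof (rule tendsto_lowerbound)
      show "((\<lambda>x. t * w x) \<longlongrightarrow> t * w a) (at_right a)"
        by (intro tendsto_intros isCont_tendsto_compose[OF _ tendsto_ident_at] cont a)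
      show "eventually (\<lambda>x. 0 \<le> t * w x) (at_right a)"
        using eventually_at_right_real[OF \<open>a < b\<close>] by eventually_elim (use t in \<open>force intro: less_imp_le\<close>)
    qed simp
    moreover have "s * v' a \<ge> 0"
    proof (rule ccontr)
      assume "\<not> s * v' a \<ge> 0"
      then obtain d where d: "d > 0" "\<And>h. 0 < h \<Longrightarrow> h < d \<Longrightarrow> s * v (a + h) < s * v a"
        using DERIV_neg_dec_right[OF Dsv[OF a(1,2)]] by (auto simp: not_le)
      define h where "h = min (d / 2) ((b - a) / 2)"
      have "0 < h" "h < d" "a < a + h" "a + h < b" using d(1) \<open>a < b\<close> by (auto simp: h_def min_def field_simps)
      then show False using d(2)[of h] s(2)[of "a + h"] a(3) by simp
    qed
    ultimately have "s * v a * (t * w' a) - s * v' a * (t * w a) \<le> 0"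
      using a(3) by simp
    then show ?thesis using lim[OF a(1,2)] by blast
  qed
  then obtain L where L: "L \<le> 0" "((\<lambda>x. s * v x * (t * w' x) - s * v' x * (t * w x)) \<longlongrightarrow> L) (at_right a)"
    by blast
  show False
  proof (rule wronskian_limits_contradiction[where v = "\<lambda>x. s * v x" and v' = "\<lambda>x. s * v' x"
        and w = "\<lambda>x. t * w x" and w' = "\<lambda>x. t * w' x" and q = q and r = r, OF \<open>a < b\<close> _ _ _ _ _ _ L(2,1) lim[OF b] Mb])
    fix x assume x: "a < x" "x < b"
    then have xc: "0 < x" "x < c" using in_c[of x] by auto
    show "((\<lambda>x. s * v x) has_real_derivative s * v' x) (at x)" by (rule Dsv[OF xc])
    show "((\<lambda>x. t * w x) has_real_derivative t * w' x) (at x)" by (rule DERIV_cmult[OF D(3)[OF xc]])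
    show "((\<lambda>x. s * v' x) has_real_derivative - q x * (s * v x)) (at x)"
      using DERIV_cmult[OF D(2)[OF xc], of s] by (simp add: mult_ac)
    show "((\<lambda>x. t * w' x) has_real_derivative - r x * (t * w x)) (at x)"
      using DERIV_cmult[OF D(4)[OF xc], of t] by (simp add: mult_ac)
    show "q x < r x" by (rule less[OF xc])
    show "0 < s * v x * (t * w x)" using s(2)[OF x] t(2)[OF x] by simp
  qed
qed

text \<open>
  The passage from interlacing to the numbering of zeros: if the values \<open>g (J k)\<close> are separated by
  the \<open>f k\<close>, then \<open>J\<close> increases strictly, so \<open>J k\<close> is at least \<open>k\<close> and \<open>g k\<close> does not exceed \<open>f k\<close>.
\<close>

lemma index_le_interlacing_index:
  fixes f g :: "nat \<Rightarrow> real"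
  assumes mono: "\<And>i j. 1 \<le> i \<Longrightarrow> i < j \<Longrightarrow> j \<le> m \<Longrightarrow> g i < g j"
    and J: "\<And>k. 1 \<le> k \<Longrightarrow> k \<le> n \<Longrightarrow> 1 \<le> J k \<and> J k \<le> m \<and> g (J k) \<le> f k"
      "\<And>k. 1 < k \<Longrightarrow> k \<le> n \<Longrightarrow> f (k - 1) < g (J k)"
    and k: "1 \<le> k" "k \<le> n"
  shows "k \<le> J k"
  using k
proof (induction k)
  case 0
  then show ?case by simp
next
  case (Suc k)
  show ?case
  proof (cases "k = 0")
    case True
    then show ?thesis using J(1)[of "Suc k"] Suc.prems by simp
  next
    case False
    then have "g (J k) < g (J (Suc k))" "k \<le> J k"
      using J(1)[of k] J(2)[of "Suc k"] Suc by auto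
    then have "J k < J (Suc k)"
      using mono[of "J (Suc k)" "J k"] J(1)[of k] J(1)[of "Suc k"] Suc.prems False
      by (cases "J k" "J (Suc k)" rule: linorder_cases) auto
    then show ?thesis using \<open>k \<le> J k\<close> by simp
  qed
qed

section \<open>The Wronskian at the singular endpoint\<close>

text \<open>
  The product is of order \<open>x powr (2 a + 2)\<close>, since each factor is of order \<open>x powr (a + 1/2)\<close>.
  The additional \<open>x\<close> is what keeps the exponent positive down to \<open>a = -1\<close>.
\<close>

lemma tendsto_liouville_factor_product:
  assumes a: "a > -1" and g: "g > 0" "h > 0"
  shows "((\<lambda>x. liouville_factor a b (x / g) * liouville_factor a b (x / h) * x) \<longlongrightarrow> 0) (at_right 0)"
proof -
  let ?s = "\<lambda>g x. (sin (x / g / 2) / x) powr (a + 1/2)" and ?c = "\<lambda>g x. cos (x / g / 2) powr (b + 1/2)"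
  have s: "((\<lambda>x. sin (x / g / 2) / x) \<longlongrightarrow> 1 / (2 * g)) (at_right 0)" if "g > 0" for g :: real
    using that by (real_asymp simp: field_simps)
  have s': "(?s g \<longlongrightarrow> (1 / (2 * g)) powr (a + 1/2)) (at_right 0)" if "g > 0" for g :: real
    using that by (intro tendsto_powr s tendsto_const) auto
  have c': "(?c g \<longlongrightarrow> 1 powr (b + 1/2)) (at_right 0)" if "g > 0" for g :: real
  proof (intro tendsto_powr tendsto_const)
    show "((\<lambda>x. cos (x / g / 2)) \<longlongrightarrow> 1) (at_right 0)" using that by real_asymp
  qed simp
  have "((\<lambda>x::real. x powr (2 * a + 2)) \<longlongrightarrow> 0) (at_right 0)"
    by (rule tendsto_zero_powrI[where b = "2 * a + 2"])
       (use a in \<open>auto intro!: tendsto_intros eventually_at_right_less eventually_mono[OF eventually_at_right_less]\<close>)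
  from tendsto_mult[OF tendsto_mult[OF tendsto_mult[OF s'[OF g(1)] s'[OF g(2)]] this]
      tendsto_mult[OF c'[OF g(1)] c'[OF g(2)]]]
  have lim: "((\<lambda>x. ?s g x * ?s h x * x powr (2 * a + 2) * (?c g x * ?c h x)) \<longlongrightarrow> 0) (at_right 0)"
    by simp
  have pos: "eventually (\<lambda>x. sin (x / g / 2) > 0) (at_right 0)" if "g > 0" for g :: real
    using that by real_asymp
  have "eventually (\<lambda>x. ?s g x * ?s h x * x powr (2 * a + 2) * (?c g x * ?c h x) =
      liouville_factor a b (x / g) * liouville_factor a b (x / h) * x) (at_right 0)"
    using eventually_at_right_less[of 0] pos[OF g(1)] pos[OF g(2)]
  proof eventually_elim
    case (elim x)
    have "x powr (2 * a + 2) = x powr (a + 1/2) * x powr (a + 1/2) * x"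
    proof -
      have "x powr (2 * a + 2) = x powr ((a + 1/2) + (a + 1/2) + 1)" by (simp add: algebra_simps)
      then show ?thesis using elim(1) by (simp only: powr_add) simp
    qed
    then show ?case
      using elim by (simp add: liouville_factor_def powr_divide)
  qed
  then show ?thesis
    by (rule Lim_transform_eventually[OF lim])
qed

text \<open>
  Each scaled logarithmic derivative has the pole \<open>(a + 1/2) / x\<close>, which does not depend on the
  scale, so the poles cancel and the difference is of order \<open>x\<close>.
\<close>

lemma tendsto_log_deriv_difference:
  assumes g: "g > 0" "h > 0"
  shows "((\<lambda>x. (liouville_log_deriv a b (x / h) / h - liouville_log_deriv a b (x / g) / g) / x) \<longlongrightarrow>
     ((a + 1/2) * (1 / (6 * g\<^sup>2) - 1 / (6 * h\<^sup>2)) - (b + 1/2) * (1 / (2 * h\<^sup>2) - 1 / (2 * g\<^sup>2))) / 2) (at_right 0)"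
proof -
  have 1: "((\<lambda>x. (cos (x / h / 2) / sin (x / h / 2) / h - cos (x / g / 2) / sin (x / g / 2) / g) / x)
      \<longlongrightarrow> 1 / (6 * g\<^sup>2) - 1 / (6 * h\<^sup>2)) (at_right 0)"
    using g by (real_asymp simp: field_simps power2_eq_square)
  have 2: "((\<lambda>x. (sin (x / h / 2) / cos (x / h / 2) / h - sin (x / g / 2) / cos (x / g / 2) / g) / x)
      \<longlongrightarrow> 1 / (2 * h\<^sup>2) - 1 / (2 * g\<^sup>2)) (at_right 0)"
    using g by (real_asymp simp: field_simps power2_eq_square)
  have "((\<lambda>x. ((a + 1/2) * ((cos (x / h / 2) / sin (x / h / 2) / h - cos (x / g / 2) / sin (x / g / 2) / g) / x)
       - (b + 1/2) * ((sin (x / h / 2) / cos (x / h / 2) / h - sin (x / g / 2) / cos (x / g / 2) / g) / x)) / 2)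
      \<longlongrightarrow> ((a + 1/2) * (1 / (6 * g\<^sup>2) - 1 / (6 * h\<^sup>2)) - (b + 1/2) * (1 / (2 * h\<^sup>2) - 1 / (2 * g\<^sup>2))) / 2) (at_right 0)"
    by (intro tendsto_intros 1 2) simp
  moreover have "((a + 1/2) * ((cos (x / h / 2) / sin (x / h / 2) / h - cos (x / g / 2) / sin (x / g / 2) / g) / x)
       - (b + 1/2) * ((sin (x / h / 2) / cos (x / h / 2) / h - sin (x / g / 2) / cos (x / g / 2) / g) / x)) / 2
     = (liouville_log_deriv a b (x / h) / h - liouville_log_deriv a b (x / g) / g) / x" for x
    unfolding liouville_log_deriv_def by (simp add: algebra_simps add_divide_distrib diff_divide_distrib)
  ultimately show ?thesis by (simp only:)
qed

text \<open>
  The Liouville factors can be taken out of the Wronskian. Every term that is left contains either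
  the difference of the logarithmic derivatives or a factor \<open>sin (x / g)\<close> or \<open>sin (x / h)\<close>, and
  hence a factor of order \<open>x\<close>, which goes to \<open>tendsto_liouville_factor_product\<close>.
\<close>

lemma tendsto_jacobi_wronskian:
  assumes a: "a > -1" and g: "g > 0" "h > 0"
  shows "((\<lambda>x. jacobi_normal a b n (x / g) * (jacobi_normal' a b m (x / h) / h)
              - jacobi_normal' a b n (x / g) / g * jacobi_normal a b m (x / h)) \<longlongrightarrow> 0) (at_right 0)"
proof -
  let ?p = "\<lambda>x. poly (jacobi_poly a b n) (cos (x / g))" and ?p' = "\<lambda>x. poly (pderiv (jacobi_poly a b n)) (cos (x / g))"
  let ?q = "\<lambda>x. poly (jacobi_poly a b m) (cos (x / h))" and ?q' = "\<lambda>x. poly (pderiv (jacobi_poly a b m)) (cos (x / h))"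
  let ?m = "\<lambda>x. liouville_factor a b (x / g) * liouville_factor a b (x / h) * x"
  let ?l = "\<lambda>x. (liouville_log_deriv a b (x / h) / h - liouville_log_deriv a b (x / g) / g) / x"
  let ?s = "\<lambda>g x. sin (x / g) / x"
  have c: "((\<lambda>x. cos (x / g)) \<longlongrightarrow> 1) (at_right 0)" if "g > 0" for g :: real
    using that by real_asymp
  have P: "((\<lambda>x. poly P (cos (x / g))) \<longlongrightarrow> poly P 1) (at_right 0)" if "g > 0" for g :: real and P
    by (rule isCont_tendsto_compose[OF poly_isCont c[OF that]])
  have s: "(?s g \<longlongrightarrow> 1 / g) (at_right 0)" if "g > 0" for g :: real
    using that by (real_asymp simp: field_simps)
  note l = tendsto_log_deriv_difference[OF g, of a b]
  note sg = tendsto_divide[OF s[OF g(1)] tendsto_const[of g]] and sh = tendsto_divide[OF s[OF g(2)] tendsto_const[of h]]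
  note bracket = tendsto_add[OF tendsto_diff[OF
      tendsto_mult[OF tendsto_mult[OF P[OF g(1)] P[OF g(2)]] l]
      tendsto_mult[OF tendsto_mult[OF P[OF g(1)] P[OF g(2)]] sh]]
      tendsto_mult[OF tendsto_mult[OF P[OF g(1)] P[OF g(2)]] sg]]
  have "((\<lambda>x. ?m x * (?p x * ?q x * ?l x - ?p x * ?q' x * (?s h x / h) + ?p' x * ?q x * (?s g x / g))) \<longlongrightarrow> 0) (at_right 0)"
    by (rule tendsto_eq_rhs[OF tendsto_mult[OF tendsto_liouville_factor_product[OF a g, of b] bracket]])
      (use g in auto)
  then show ?thesis
  proof (rule Lim_transform_eventually)
    show "eventually (\<lambda>x. ?m x * (?p x * ?q x * ?l x - ?p x * ?q' x * (?s h x / h) + ?p' x * ?q x * (?s g x / g)) =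
      jacobi_normal a b n (x / g) * (jacobi_normal' a b m (x / h) / h)
              - jacobi_normal' a b n (x / g) / g * jacobi_normal a b m (x / h)) (at_right 0)"
      using eventually_at_right_less[of 0]
    proof eventually_elim
      case (elim x)
      then show ?case using g
        unfolding jacobi_normal_def jacobi_normal'_def by (simp add: field_simps)
    qed
  qed
qed

section \<open>The scaled equation and its coefficient\<close>

lemma jacobi_gamma_pos:
  assumes "a > -1" "b > -1" "n \<ge> 1"
  shows "jacobi_gamma a b n > 0"
proof -
  have "real n \<ge> 1" using assms by simp
  then have "jacobi_gamma a b n \<ge> 1 + (a + b + 1) / 2" by (simp add: jacobi_gamma_def)
  then show ?thesis using assms by (simp add: field_simps)
qed

lemma DERIV_scaled_jacobi_normal:
  assumes "g > 0" "0 < x" "x < pi * g"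
  shows "((\<lambda>x. jacobi_normal a b n (x / g)) has_real_derivative jacobi_normal' a b n (x / g) / g) (at x)"
proof -
  have t: "0 < x / g" "x / g < pi" using assms by (simp_all add: divide_less_eq)
  have "((\<lambda>x. x / g) has_real_derivative 1 / g) (at x)"
    using DERIV_cdivide[OF DERIV_ident] .
  from DERIV_chain2[OF DERIV_jacobi_normal[OF t] this] show ?thesis by simp
qed

lemma DERIV_scaled_jacobi_normal':
  assumes "jacobi_gamma a b n = g" "g > 0" "0 < x" "x < pi * g"
  shows "((\<lambda>x. jacobi_normal' a b n (x / g) / g) has_real_derivative
           - (1 + jacobi_potential a b (x / g) / g\<^sup>2) * jacobi_normal a b n (x / g)) (at x)"
proof -
  have t: "0 < x / g" "x / g < pi" using assms by (simp_all add: divide_less_eq)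
  have "((\<lambda>x. x / g) has_real_derivative 1 / g) (at x)"
    using DERIV_cdivide[OF DERIV_ident] .
  from DERIV_cdivide[OF DERIV_chain2[OF DERIV_jacobi_normal'[OF t] this], of a b n g]
  show ?thesis
    unfolding assms(1) by (rule DERIV_cong) (use assms(2) in \<open>simp add: field_simps power2_eq_square\<close>)
qed

lemma scaled_potential_eq:
  assumes "g > 0" "x > 0"
  shows "jacobi_potential a b (x / g) / g\<^sup>2 =
    ((1/4 - a\<^sup>2) * (x / (2 * g) / sin (x / (2 * g)))\<^sup>2
      + (1/4 - b\<^sup>2) * (x / (2 * g) / cos (x / (2 * g)))\<^sup>2) / x\<^sup>2"
proof -
  have "x / g / 2 = x / (2 * g)" by simp
  moreover have "A / (4 * s\<^sup>2) / g\<^sup>2 = A * (x / (2 * g) / s)\<^sup>2 / x\<^sup>2" for A s :: real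
    using assms by (simp add: power_divide power_mult_distrib)
  ultimately show ?thesis
    by (simp only: jacobi_potential_def add_divide_distrib)
qed

lemma scaled_potential_less:
  assumes D: "(a, b) \<in> D_down" "\<not> (\<bar>a\<bar> = 1/2 \<and> \<bar>b\<bar> = 1/2)"
    and x: "0 < g" "g < h" "0 < x" "x < pi * g"
  shows "1 + jacobi_potential a b (x / g) / g\<^sup>2 < 1 + jacobi_potential a b (x / h) / h\<^sup>2"
proof -
  have "(1/2)\<^sup>2 \<le> \<bar>b\<bar>\<^sup>2" using D(1) by (intro power_mono) (auto simp: D_down_def)
  then have b: "1/4 - b\<^sup>2 \<le> 0" by (simp add: power2_eq_square)
  have ab: "(1/4 - a\<^sup>2) + 3 * (1/4 - b\<^sup>2) \<le> 0"
    using D(1) by (auto simp: D_down_def)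
  have corner: "\<bar>c\<bar> = 1/2" if "1/4 - c\<^sup>2 = 0" for c :: real
  proof -
    have "c\<^sup>2 = (1/2)\<^sup>2" using that by (simp add: power2_eq_square)
    then show ?thesis by (auto simp: power2_eq_iff)
  qed
  have ne: "1/4 - a\<^sup>2 \<noteq> 0 \<or> 1/4 - b\<^sup>2 \<noteq> 0"
    using D(2) corner by blast
  have "0 < x / (2 * h)" "x / (2 * h) < x / (2 * g)" "x / (2 * g) < pi / 2"
    using x by (simp_all add: field_simps)
  from weighted_sq_quotients_decrease[OF this b ab ne] show ?thesis
    using x by (simp add: scaled_potential_eq divide_strict_right_mono)
qed

section \<open>Zeros of the normal form\<close>

lemma jacobi_normal_eq_0_iff:
  assumes "0 < t" "t < pi"
  shows "jacobi_normal a b n t = 0 \<longleftrightarrow> t \<in> jacobi_angles a b n"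
  using liouville_factor_pos[OF assms, of a b] assms by (auto simp: jacobi_normal_def jacobi_angles_def)

lemma jacobi_angle_index:
  assumes "a > -1" "b > -1" "t \<in> jacobi_angles a b n"
  obtains j where "1 \<le> j" "j \<le> n" "t = jacobi_theta a b n j"
proof -
  have "t \<in> set (sorted_list_of_set (jacobi_angles a b n))"
    using assms(3) finite_jacobi_angles[OF assms(1,2)] by simp
  then obtain i where "i < n" "sorted_list_of_set (jacobi_angles a b n) ! i = t"
    by (auto simp: in_set_conv_nth card_jacobi_angles[OF assms(1,2)])
  then show ?thesis using that[of "Suc i"] by (simp add: jacobi_theta_def)
qed

text \<open>
  A multiple zero would leave all \<open>n\<close> distinct zeros to a factor of degree \<open>n - 1\<close>.
\<close>

lemma jacobi_root_simple:
  assumes ab: "a > -1" "b > -1" and x: "-1 < x" "x < 1" "poly (jacobi_poly a b n) x = 0"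
  shows "poly (pderiv (jacobi_poly a b n)) x \<noteq> 0"
proof
  assume d: "poly (pderiv (jacobi_poly a b n)) x = 0"
  define p where "p = jacobi_poly a b n"
  let ?R = "{y. -1 < y \<and> y < 1 \<and> poly p y = 0}"
  have card: "card ?R = n" using card_jacobi_poly_roots[OF ab, of n] by (simp add: p_def)
  have "n \<noteq> 0" using x by (cases n) (auto simp: jacobi_poly_def)
  then have "p \<noteq> 0" using degree_jacobi_poly[OF ab, of n] by (auto simp: p_def)
  obtain q where q: "p = [:-x, 1:] * q"
    using x(3) by (auto simp: p_def poly_eq_0_iff_dvd elim: dvdE)
  have "q \<noteq> 0" using \<open>p \<noteq> 0\<close> q by auto
  have "poly q x = 0"
    using d unfolding p_def[symmetric] q by (simp add: pderiv_mult pderiv_pCons del: mult_pCons_left)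
  then have "?R \<subseteq> {y. poly q y = 0}" unfolding q by auto
  then have "n \<le> card {y. poly q y = 0}"
    using card_mono[OF poly_roots_finite[OF \<open>q \<noteq> 0\<close>]] card by metis
  also have "\<dots> \<le> degree q" by (rule card_poly_roots_bound[OF \<open>q \<noteq> 0\<close>])
  also have "degree q < degree p"
    unfolding q using \<open>q \<noteq> 0\<close> by (subst degree_mult_eq) auto
  also have "\<dots> = n" using degree_jacobi_poly[OF ab] by (simp add: p_def)
  finally show False by simp
qed

lemma jacobi_normal'_nonzero:
  assumes ab: "a > -1" "b > -1" and t: "t \<in> jacobi_angles a b n"
  shows "jacobi_normal' a b n t \<noteq> 0"
proof -
  have t': "0 < t" "t < pi" "poly (jacobi_poly a b n) (cos t) = 0"
    using t by (auto simp: jacobi_angles_def)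
  have "-1 < cos t" "cos t < 1"
    using cos_monotone_0_pi[of 0 t] cos_monotone_0_pi[of t pi] t' by auto
  then show ?thesis
    using jacobi_root_simple[OF ab _ _ t'(3)] liouville_factor_pos[OF t'(1,2), of a b] sin_gt_zero[OF t'(1,2)] t'(3)
    by (simp add: jacobi_normal'_def)
qed

section \<open>Comparison of the scaled zeros\<close>

lemma scaled_jacobi_theta_less:
  assumes D: "(a, b) \<in> D_down" "\<not> (\<bar>a\<bar> = 1/2 \<and> \<bar>b\<bar> = 1/2)"
    and nm: "n < m" and k: "1 \<le> k" "k \<le> n"
  shows "jacobi_gamma a b m * jacobi_theta a b m k < jacobi_gamma a b n * jacobi_theta a b n k"
proof -
  have ab: "a > -1" "b > -1" using D(1) by (auto simp: D_down_def)
  define g where "g = jacobi_gamma a b n"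
  define h where "h = jacobi_gamma a b m"
  have g: "g > 0" and gh: "g < h"
    using jacobi_gamma_pos[OF ab, of n] k nm by (auto simp: g_def h_def jacobi_gamma_def)
  then have h: "h > 0" by simp
  let ?f = "\<lambda>k. g * jacobi_theta a b n k" and ?e = "\<lambda>k. h * jacobi_theta a b m k"
  let ?v = "\<lambda>x. jacobi_normal a b n (x / g)" and ?v' = "\<lambda>x. jacobi_normal' a b n (x / g) / g"
  let ?w = "\<lambda>x. jacobi_normal a b m (x / h)" and ?w' = "\<lambda>x. jacobi_normal' a b m (x / h) / h"
  have less_h: "x < pi * h" if "x < pi * g" for x
    using that gh by (metis mult_strict_left_mono order.strict_trans pi_gt_zero)
  have f: "0 < ?f i" "?f i < pi * g" "?v (?f i) = 0" if "1 \<le> i" "i \<le> n" for i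
    using jacobi_theta_in_angles[OF ab that] g
    by (auto simp: jacobi_normal_eq_0_iff jacobi_angles_def mult.commute)
  have f_mono: "?f i < ?f j" if "1 \<le> i" "i < j" "j \<le> n" for i j
    using jacobi_theta_strict_mono[OF ab that] g by simp
  have e_mono: "?e i < ?e j" if "1 \<le> i" "i < j" "j \<le> m" for i j
    using jacobi_theta_strict_mono[OF ab that] h by simp
  have "\<exists>j. 1 \<le> j \<and> j \<le> m \<and> ?e j < ?f k \<and> (1 < k \<longrightarrow> ?f (k - 1) < ?e j)" if k: "1 \<le> k" "k \<le> n" for k
  proof -
    \<comment> \<open>The left neighbour of the \<open>k\<close>-th zero of \<open>?v\<close>, or the singular endpoint if there is none.\<close>
    define l where "l = (if k = 1 then 0 else ?f (k - 1))"
    have l: "0 \<le> l" "l < ?f k" "l = 0 \<or> ?v l = 0"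
    proof -
      have "0 < ?f (k - 1) \<and> ?v (?f (k - 1)) = 0" if "k \<noteq> 1"
        using f(1,3)[of "k - 1"] that k by linarith
      then show "0 \<le> l" "l = 0 \<or> ?v l = 0"
        by (simp_all add: l_def less_imp_le)
      show "l < ?f k"
        using f(1)[OF k] f_mono[of "k - 1" k] k by (auto simp: l_def)
    qed
    have "\<exists>x. l < x \<and> x < ?f k \<and> ?w x = 0"
    proof (rule sturm_zero_between[where v = ?v and v' = ?v' and w' = ?w' and c = "pi * g"
          and q = "\<lambda>x. 1 + jacobi_potential a b (x / g) / g\<^sup>2"
          and r = "\<lambda>x. 1 + jacobi_potential a b (x / h) / h\<^sup>2", OF l(1,2) f(2)[OF k]])
      fix x assume x: "0 < x" "x < pi * g"
      then have xh: "x < pi * h" by (intro less_h)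
      show "(?v has_real_derivative ?v' x) (at x)" "(?w has_real_derivative ?w' x) (at x)"
        using DERIV_scaled_jacobi_normal x xh g h by auto
      show "(?v' has_real_derivative - (1 + jacobi_potential a b (x / g) / g\<^sup>2) * ?v x) (at x)"
        by (rule DERIV_scaled_jacobi_normal'[OF g_def[symmetric] g x])
      show "(?w' has_real_derivative - (1 + jacobi_potential a b (x / h) / h\<^sup>2) * ?w x) (at x)"
        by (rule DERIV_scaled_jacobi_normal'[OF h_def[symmetric] h x(1) xh])
      show "1 + jacobi_potential a b (x / g) / g\<^sup>2 < 1 + jacobi_potential a b (x / h) / h\<^sup>2"
        by (rule scaled_potential_less[OF D g gh x])
    next
      show "((\<lambda>x. ?v x * ?w' x - ?v' x * ?w x) \<longlongrightarrow> 0) (at_right 0)"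
        by (rule tendsto_jacobi_wronskian[OF ab(1) g h])
    next
      fix x assume x: "l < x" "x < ?f k"
      show "?v x \<noteq> 0"
      proof
        assume "?v x = 0"
        have "0 < x" "x < pi * g" using x l(1) f(2)[OF k] by linarith+
        then have "0 < x / g" "x / g < pi" using g by (simp_all add: divide_less_eq)
        then obtain j where j: "1 \<le> j" "j \<le> n" "x / g = jacobi_theta a b n j"
          using jacobi_angle_index[OF ab] \<open>?v x = 0\<close> jacobi_normal_eq_0_iff by blast
        then have xj: "x = ?f j" using g by (simp add: field_simps)
        have "j < k"
          using x(2) f_mono[of k j] j k unfolding xj by (cases j k rule: linorder_cases) auto
        then have "?f j \<le> l"
        proof (cases "j = k - 1")
          case True
          then have "k \<noteq> 1" using j(1) by auto
          then show ?thesis using True by (simp add: l_def)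
        next
          case False
          then have "j < k - 1" "k - 1 \<le> n" using \<open>j < k\<close> k by auto
          then show ?thesis using f_mono[OF j(1)] by (simp add: l_def less_imp_le)
        qed
        then show False using x xj by simp
      qed
    qed (use l f(3)[OF k] in auto)
    then obtain x where x: "l < x" "x < ?f k" "?w x = 0" by blast
    have "0 < x" "x < pi * h"
      using x(1,2) l(1) f(2)[OF k] less_h[of x] by linarith+
    then have "0 < x / h" "x / h < pi" using h by (simp_all add: divide_less_eq)
    then obtain j where j: "1 \<le> j" "j \<le> m" "x / h = jacobi_theta a b m j"
      using jacobi_angle_index[OF ab] x(3) jacobi_normal_eq_0_iff by blast
    then have "x = ?e j" using h by (simp add: field_simps)
    then show ?thesis using j x by (auto simp: l_def)
  qed
  then obtain J where J: "\<And>k. 1 \<le> k \<Longrightarrow> k \<le> n \<Longrightarrow>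
      1 \<le> J k \<and> J k \<le> m \<and> ?e (J k) < ?f k \<and> (1 < k \<longrightarrow> ?f (k - 1) < ?e (J k))"
    by metis
  have "k \<le> J k"
    by (rule index_le_interlacing_index[of m ?e n J ?f, OF e_mono _ _ k])
      (use J in \<open>auto intro: less_imp_le\<close>)
  then have "?e k \<le> ?e (J k)"
    using e_mono[of k "J k"] J[OF k] k by (cases "k = J k") auto
  also have "\<dots> < ?f k" using J[OF k] by blast
  finally show ?thesis by (simp add: g_def h_def)
qed

text \<open>
  Both scaled functions satisfy \<open>v'' + v = 0\<close>, so their Wronskian is constant, and the constant is 0.
  At a zero of one function, which is simple, the other must then vanish as well. The numbering is
  compared in both directions, because the function of index \<open>m\<close> has further zeros to the right of
  \<open>pi * g\<close>.
\<close>

lemma scaled_jacobi_theta_eq: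
  assumes ab: "\<bar>a\<bar> = 1/2" "\<bar>b\<bar> = 1/2" and nm: "n < m" and k: "1 \<le> k" "k \<le> n"
  shows "jacobi_gamma a b m * jacobi_theta a b m k = jacobi_gamma a b n * jacobi_theta a b n k"
proof -
  have sq: "c\<^sup>2 = 1/4" if "\<bar>c\<bar> = 1/2" for c :: real
    using power2_abs[of c] unfolding that by (simp add: power2_eq_square)
  have pot: "jacobi_potential a b t = 0" for t
    using ab by (simp add: jacobi_potential_def sq)
  have ab: "a > -1" "b > -1" using ab by auto
  define g where "g = jacobi_gamma a b n"
  define h where "h = jacobi_gamma a b m"
  have g: "g > 0" and gh: "g < h"
    using jacobi_gamma_pos[OF ab, of n] k nm by (auto simp: g_def h_def jacobi_gamma_def)
  then have h: "h > 0" by simp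
  let ?f = "\<lambda>k. g * jacobi_theta a b n k" and ?e = "\<lambda>k. h * jacobi_theta a b m k"
  let ?v = "\<lambda>x. jacobi_normal a b n (x / g)" and ?v' = "\<lambda>x. jacobi_normal' a b n (x / g) / g"
  let ?w = "\<lambda>x. jacobi_normal a b m (x / h)" and ?w' = "\<lambda>x. jacobi_normal' a b m (x / h) / h"
  have less_h: "x < pi * h" if "x < pi * g" for x
    using that gh by (metis mult_strict_left_mono order.strict_trans pi_gt_zero)
  have f: "0 < ?f i" "?f i < pi * g" if "1 \<le> i" "i \<le> n" for i
    using jacobi_theta_in_angles[OF ab that] g
    by (auto simp: jacobi_angles_def mult.commute)
  have f_mono: "?f i < ?f j" if "1 \<le> i" "i < j" "j \<le> n" for i j
    using jacobi_theta_strict_mono[OF ab that] g by simp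
  have e_mono: "?e i < ?e j" if "1 \<le> i" "i < j" "j \<le> m" for i j
    using jacobi_theta_strict_mono[OF ab that] h by simp
  have W: "?v x * ?w' x - ?v' x * ?w x = 0" if x: "0 < x" "x < pi * g" for x
  proof -
    let ?W = "\<lambda>x. ?v x * ?w' x - ?v' x * ?w x"
    have D: "(?W has_real_derivative 0) (at y)" if "y \<in> {0<..<pi * g}" for y
    proof -
      have y: "0 < y" "y < pi * g" "y < pi * h" using that less_h by auto
      have "(?W has_real_derivative ((\<lambda>x. 1) y - (\<lambda>x. 1) y) * (?v y * ?w y)) (at y)"
        using DERIV_scaled_jacobi_normal'[OF g_def[symmetric] g y(1,2)]
              DERIV_scaled_jacobi_normal'[OF h_def[symmetric] h y(1,3)]
        by (intro DERIV_wronskian DERIV_scaled_jacobi_normal g h y) (simp_all add: pot)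
      then show ?thesis by simp
    qed
    have const: "?W y = ?W x" if "y \<in> {0<..<pi * g}" for y
    proof -
      have "\<exists>c. \<forall>y\<in>{0<..<pi * g}. ?W y = c"
        using D by (intro has_field_derivative_zero_constant) (auto intro: has_field_derivative_at_within)
      then show ?thesis using that x by (metis greaterThanLessThan_iff)
    qed
    have "eventually (\<lambda>y. ?W y = ?W x) (at_right 0)"
      by (rule eventually_mono[OF eventually_at_right_real[of 0 "pi * g"] const]) (use g in simp)
    then have "(?W \<longlongrightarrow> ?W x) (at_right 0)" by (rule tendsto_eventually)
    from tendsto_unique[OF trivial_limit_at_right_real this tendsto_jacobi_wronskian[OF ab(1) g h]]
    show ?thesis .
  qed
  have same: "x / g \<in> jacobi_angles a b n \<longleftrightarrow> x / h \<in> jacobi_angles a b m" if x: "0 < x" "x < pi * g" for x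
  proof -
    have t: "0 < x / g" "x / g < pi" "0 < x / h" "x / h < pi"
      using x less_h[OF x(2)] g h by (simp_all add: divide_less_eq)
    show ?thesis
      using W[OF x] jacobi_normal'_nonzero[OF ab, of "x / g" n] jacobi_normal'_nonzero[OF ab, of "x / h" m] g h
        jacobi_normal_eq_0_iff[OF t(1,2), of a b n] jacobi_normal_eq_0_iff[OF t(3,4), of a b m]
      by auto
  qed
  have "\<exists>j. 1 \<le> j \<and> j \<le> m \<and> ?e j = ?f k" if k: "1 \<le> k" "k \<le> n" for k
  proof -
    have "?f k / h \<in> jacobi_angles a b m"
      using same[OF f[OF k]] jacobi_theta_in_angles[OF ab k] g by simp
    then obtain j where "1 \<le> j" "j \<le> m" "?f k / h = jacobi_theta a b m j"
      using jacobi_angle_index[OF ab] by blast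
    then show ?thesis using h by (intro exI[of _ j]) (simp add: field_simps)
  qed
  then obtain J where J: "\<And>k. 1 \<le> k \<Longrightarrow> k \<le> n \<Longrightarrow> 1 \<le> J k \<and> J k \<le> m \<and> ?e (J k) = ?f k"
    by metis
  have le: "?e k \<le> ?f k" if k: "1 \<le> k" "k \<le> n" for k
  proof -
    have "k \<le> J k"
      by (rule index_le_interlacing_index[of m ?e n J ?f, OF e_mono _ _ k]) (use J f_mono in auto)
    then have "?e k \<le> ?e (J k)"
      using e_mono[of k "J k"] J[OF k] k by (cases "k = J k") auto
    then show ?thesis using J[OF k] by simp
  qed
  have "\<exists>j. 1 \<le> j \<and> j \<le> n \<and> ?f j = ?e k" if k: "1 \<le> k" "k \<le> n" for k
  proof -
    have t: "jacobi_theta a b m k \<in> jacobi_angles a b m" "0 < jacobi_theta a b m k"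
      using jacobi_theta_in_angles[OF ab, of k m] k nm by (auto simp: jacobi_angles_def)
    have x: "0 < ?e k" "?e k < pi * g"
      using t h le[OF k] f(2)[OF k] by auto
    have "?e k / g \<in> jacobi_angles a b n"
      using same[OF x] t h by simp
    then obtain j where "1 \<le> j" "j \<le> n" "?e k / g = jacobi_theta a b n j"
      using jacobi_angle_index[OF ab] by blast
    then show ?thesis using g by (intro exI[of _ j]) (simp add: field_simps)
  qed
  then obtain I where I: "\<And>k. 1 \<le> k \<Longrightarrow> k \<le> n \<Longrightarrow> 1 \<le> I k \<and> I k \<le> n \<and> ?f (I k) = ?e k"
    by metis
  have "k \<le> I k"
    by (rule index_le_interlacing_index[of n ?f n I ?e, OF f_mono _ _ k]) (use I e_mono nm in auto)
  then have "?f k \<le> ?f (I k)"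
    using f_mono[of k "I k"] I[OF k] k by (cases "k = I k") auto
  then have "?f k = ?e k"
    using I[OF k] le[OF k] by simp
  then show ?thesis by (simp add: g_def h_def)
qed

theorem corollary6p1:
  "(\<forall>a b. (a, b) \<in> D_down \<longrightarrow>
      (\<forall>n\<ge>1. \<forall>k\<in>{1..n}.
         jacobi_gamma a b (n + 1) * jacobi_theta a b (n + 1) k
           \<le> jacobi_gamma a b n * jacobi_theta a b n k) \<and>
      ((\<exists>n\<ge>1. \<exists>k\<in>{1..n}.
         jacobi_gamma a b (n + 1) * jacobi_theta a b (n + 1) k
           = jacobi_gamma a b n * jacobi_theta a b n k)
        \<longleftrightarrow> \<bar>a\<bar> = 1/2 \<and> \<bar>b\<bar> = 1/2)) \<and>
   (\<forall>a b. \<bar>a\<bar> = 1/2 \<and> \<bar>b\<bar> = 1/2 \<longrightarrow>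
      (\<forall>n\<ge>1. \<forall>k\<in>{1..n}.
         jacobi_gamma a b (n + 1) * jacobi_theta a b (n + 1) k
           = jacobi_gamma a b n * jacobi_theta a b n k)) \<and>
   (\<forall>a b. (a, b) \<in> D_2 \<longrightarrow>
      (\<forall>n\<ge>1. \<forall>k\<in>{1..n}.
         jacobi_gamma a b (n + 1) * jacobi_theta a b (n + 1) k
           < jacobi_gamma a b n * jacobi_theta a b n k))"
proof -
  have corner: "\<forall>n\<ge>1. \<forall>k\<in>{1..n}. jacobi_gamma a b (n + 1) * jacobi_theta a b (n + 1) k
           = jacobi_gamma a b n * jacobi_theta a b n k" if "\<bar>a\<bar> = 1/2 \<and> \<bar>b\<bar> = 1/2" for a b
    using that by (auto intro!: scaled_jacobi_theta_eq)
  have le: "\<forall>n\<ge>1. \<forall>k\<in>{1..n}. jacobi_gamma a b (n + 1) * jacobi_theta a b (n + 1) k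
           \<le> jacobi_gamma a b n * jacobi_theta a b n k" if D: "(a, b) \<in> D_down" for a b
  proof (intro allI impI ballI)
    fix n k :: nat assume "1 \<le> n" "k \<in> {1..n}"
    then show "jacobi_gamma a b (n + 1) * jacobi_theta a b (n + 1) k \<le> jacobi_gamma a b n * jacobi_theta a b n k"
      using scaled_jacobi_theta_less[OF D, of n "n + 1" k] scaled_jacobi_theta_eq[of a b n "n + 1" k]
      by (cases "\<bar>a\<bar> = 1/2 \<and> \<bar>b\<bar> = 1/2") auto
  qed
  have eq_iff: "(\<exists>n\<ge>1. \<exists>k\<in>{1..n}. jacobi_gamma a b (n + 1) * jacobi_theta a b (n + 1) k
           = jacobi_gamma a b n * jacobi_theta a b n k) \<longleftrightarrow> \<bar>a\<bar> = 1/2 \<and> \<bar>b\<bar> = 1/2" if D: "(a, b) \<in> D_down" for a b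
  proof
    assume "\<exists>n\<ge>1. \<exists>k\<in>{1..n}. jacobi_gamma a b (n + 1) * jacobi_theta a b (n + 1) k
           = jacobi_gamma a b n * jacobi_theta a b n k"
    then obtain n k where "1 \<le> k" "k \<le> n" "jacobi_gamma a b (n + 1) * jacobi_theta a b (n + 1) k
           = jacobi_gamma a b n * jacobi_theta a b n k"
      by auto
    then show "\<bar>a\<bar> = 1/2 \<and> \<bar>b\<bar> = 1/2"
      using scaled_jacobi_theta_less[OF D, of n "n + 1" k] by auto
  next
    assume "\<bar>a\<bar> = 1/2 \<and> \<bar>b\<bar> = 1/2"
    then show "\<exists>n\<ge>1. \<exists>k\<in>{1..n}. jacobi_gamma a b (n + 1) * jacobi_theta a b (n + 1) k
           = jacobi_gamma a b n * jacobi_theta a b n k"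
      using scaled_jacobi_theta_eq[of a b 1 "1 + 1" 1] by (intro exI[of _ 1]) auto
  qed
  have strict: "\<forall>n\<ge>1. \<forall>k\<in>{1..n}. jacobi_gamma a b (n + 1) * jacobi_theta a b (n + 1) k
           < jacobi_gamma a b n * jacobi_theta a b n k" if D2: "(a, b) \<in> D_2" for a b
  proof -
    have sq: "1/4 \<le> c\<^sup>2" if "1/2 \<le> \<bar>c\<bar>" for c :: real
      using power_mono[OF that, of 2] by (simp add: power2_eq_square)
    have "a\<^sup>2 + 3 * b\<^sup>2 \<ge> 1"
      using D2 sq[of a] sq[of b] by (auto simp: D_2_def)
    then have "(a, b) \<in> D_down" "\<not> (\<bar>a\<bar> = 1/2 \<and> \<bar>b\<bar> = 1/2)"
      using D2 by (auto simp: D_2_def D_down_def abs_if split: if_splits)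
    then show ?thesis
      by (auto intro!: scaled_jacobi_theta_less simp del: One_nat_def)
  qed
  show ?thesis using corner le eq_iff strict by blast
qed

end
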